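(* Assume (A1)–(A4) (stated in the context), $h_n\to0$ and $nh_n\to\infty$ as $n\to\infty$. Then $$\hat{\Lambda}_n:=\frac{1}{2n}\sum_{i=0}^{n-1}\left(Y_{(i+1)h_n}-Y_{ih_n}\right)\left(Y_{(i+1)h_n}-Y_{ih_n}\right)^T$$ is a consistent estimator of $\Lambda_\star$, i.e. $\hat{\Lambda}_n\to\Lambda_\star$ in probability as $n\to\infty$.
   Context: Setting. Let $\Theta_1\subset\mathbb{R}^{m_1}$, $\Theta_2\subset\mathbb{R}^{m_2}$ be compact convex sets, $\Theta=\Theta_1\times\Theta_2$, and let $b:\mathbb{R}^d\times\Theta_2\to\mathbb{R}^d$, $a:\mathbb{R}^d\times\Theta_1\to\mathbb{R}^d\otimes\mathbb{R}^r$ ($d\times r$ matrices) be known functions. The true parameter is $\theta^\star=(\alpha^\star,\beta^\star)\in\mathrm{Int}(\Theta)$. Write $b(x)=b(x,\beta^\star)$, $a(x)=a(x,\alpha^\star)$. The process $X$ is the $d$-dimensional solution of $dX_t=b(X_t,\beta^\star)dt+a(X_t,\alpha^\star)dw_t$, $X_0=x_0$, where $w$ is an $r$-dimensional standard Wiener process and $x_0$ is an $\mathbb{R}^d$-valued random variable independent of $w$. Observations: $Y_{ih_n}=X_{ih_n}+\Lambda_\star^{1/2}\epsilon_{ih_n}$, $i=0,\ldots,n$, where $h_n>0$, $\Lambda_\star$ is a $d\times d$ positive semi-definite matrix with $\mathrm{vech}(\Lambda_\star)\in\mathrm{Int}(\Theta_\epsilon)$ for a compact convex set $\Theta_\epsilon\subset\mathbb{R}^{d(d+1)/2}$,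 and $(\epsilon_{ih_n})_i$ are i.i.d. $\mathbb{R}^d$-valued with mean $0$ and covariance $I_d$, with components independent of each other and of $w$ and $x_0$. A function $g$ on $\mathbb{R}^d\times\Theta$ has polynomial growth uniformly in $\theta$ if $\sup_{\theta}|g(x,\theta)|\le C(1+\|x\|)^C$ for all $x$, for some $C>0$. (A1) $b$ and $a$ are 4 times continuously differentiable, and their components and those of their derivatives are of polynomial growth uniformly in $\theta\in\Theta$. Moreover there is $C>0$ such that for all $x$, $\|b(x)\|+\|b'(x)\|+\|b''(x)\|\le C(1+\|x\|)$ and $\|a(x)\|+\|a'(x)\|+\|a''(x)\|\le C(1+\|x\|)$ (derivatives in $x$). (A2) $X$ is ergodic and its invariant measure $\nu_0$ has finite $k$-th moment for all $k>0$. (A3) For all $k>0$, $\sup_{t\ge0}\mathbf{E}[\|X_t\|^k]<\infty$. (A4) For any $k>0$, $\epsilon_{ih_n}$ has finite $k$-th moment; the components of $\epsilon_{ih_n}$ are independent of the other components, of $w$ and of $x_0$; and the marginal distribution of each component is symmetric. *)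

theory Defs
  imports "HOL-Probability.Probability"
begin

section \<open>Symmetric matrices and vech\<close>

text \<open>
  The index type of \<open>vech\<close>: positions on or below the diagonal of a \<open>d \<times> d\<close> matrix.  With
  \<open>d = CARD('d)\<close> the space \<open>real ^ 'd low_pos\<close> is Euclidean space of dimension \<open>d (d + 1) / 2\<close>
  (lemma \<open>card_low_pos\<close>).
\<close>

typedef (overloaded) ('d :: linorder) low_pos = "{(i :: 'd, j :: 'd). j \<le> i}"
  by auto

instance low_pos :: ("{finite, linorder}") finite
proof
  have "inj (Rep_low_pos :: 'a low_pos \<Rightarrow> 'a \<times> 'a)"
    by (simp add: inj_def Rep_low_pos_inject)
  then show "finite (UNIV :: 'a low_pos set)"
    by (rule finite_imageD[rotated]) simp
qed

lemma card_low_pos: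
  "2 * CARD('d :: {finite, linorder} low_pos) = CARD('d) * (CARD('d) + 1)"
proof -
  let ?L = "{(i :: 'd, j :: 'd). j \<le> i}" and ?U = "{(i :: 'd, j :: 'd). i \<le> j}"
  let ?D = "(\<lambda>i :: 'd. (i, i)) ` UNIV"
  have L: "CARD('d low_pos) = card ?L"
    by (rule type_definition.card[OF type_definition_low_pos])
  have "?U = prod.swap ` ?L"
    by (auto simp: image_iff)
  then have U: "card ?U = card ?L"
    by (simp add: card_image)
  have "?L \<union> ?U = UNIV" "?L \<inter> ?U = ?D"
    by (auto simp: image_iff)
  moreover have "card ?D = CARD('d)"
    by (simp add: card_image inj_on_def)
  moreover have "card ?L + card ?U = card (?L \<union> ?U) + card (?L \<inter> ?U)"
    by (rule card_Un_Int) auto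
  ultimately have "2 * card ?L = CARD('d \<times> 'd) + CARD('d)"
    using U by simp
  then show ?thesis
    by (simp add: L)
qed

definition vech ::
  "((real, 'd :: {finite, linorder}) vec, 'd) vec \<Rightarrow> (real, 'd low_pos) vec" where
  "vech A = (\<chi> p. A $ fst (Rep_low_pos p) $ snd (Rep_low_pos p))"

definition pos_semidef :: "real ^ 'd ^ 'd \<Rightarrow> bool" where
  "pos_semidef A \<longleftrightarrow> transpose A = A \<and> (\<forall>x. 0 \<le> x \<bullet> (A *v x))"

text \<open>\<open>S\<close> is the (unique) positive semi-definite square root of \<open>A\<close>.\<close>

definition psd_sqrt :: "real ^ 'd ^ 'd \<Rightarrow> real ^ 'd ^ 'd \<Rightarrow> bool" where
  "psd_sqrt A S \<longleftrightarrow> pos_semidef S \<and> S ** S = A"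

definition outer :: "real ^ 'd \<Rightarrow> real ^ 'd ^ 'd" where
  "outer v = (\<chi> i j. v $ i * v $ j)"


section \<open>Regularity of the coefficients\<close>

text \<open>
  Iterated directional derivatives of \<open>f\<close> within \<open>S\<close>.  Below, \<open>S\<close> is either the whole space or
  \<open>UNIV \<times> \<Theta>\<close> with \<open>\<Theta>\<close> convex with nonempty interior, so derivatives within \<open>S\<close> are unique, also at
  boundary points, and \<open>frechet_derivative\<close> denotes the derivative whenever it exists.
\<close>

primrec partials ::
  "'v :: euclidean_space set \<Rightarrow> 'v list \<Rightarrow> ('v \<Rightarrow> 'b :: real_normed_vector) \<Rightarrow> 'v \<Rightarrow> 'b" where
  "partials S [] f = f"
| "partials S (v # vs) f = (\<lambda>z. frechet_derivative (partials S vs f) (at z within S) v)"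

definition Ck_on :: "nat \<Rightarrow> 'v :: euclidean_space set \<Rightarrow> ('v \<Rightarrow> 'b :: real_normed_vector) \<Rightarrow> bool" where
  "Ck_on k S f \<longleftrightarrow>
     (\<forall>vs. set vs \<subseteq> Basis \<longrightarrow>
        (length vs < k \<longrightarrow> partials S vs f differentiable_on S) \<and>
        (length vs \<le> k \<longrightarrow> continuous_on S (partials S vs f)))"

definition poly_growth ::
  "'p set \<Rightarrow> ('x :: real_normed_vector \<times> 'p \<Rightarrow> real) \<Rightarrow> bool" where
  "poly_growth \<Theta> g \<longleftrightarrow>
     (\<exists>C>0. \<forall>x. \<forall>\<theta>\<in>\<Theta>. \<bar>g (x, \<theta>)\<bar> \<le> C * (1 + norm x) powr C)"

text \<open>A real-valued component \<open>f\<close> of a coefficient, as a function of state and parameter.\<close>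

definition smooth_coeff ::
  "'p :: euclidean_space set \<Rightarrow> ('x :: euclidean_space \<times> 'p \<Rightarrow> real) \<Rightarrow> bool" where
  "smooth_coeff \<Theta> f \<longleftrightarrow>
     Ck_on 4 (UNIV \<times> \<Theta>) f \<and>
     (\<forall>vs. set vs \<subseteq> Basis \<and> length vs \<le> 4 \<longrightarrow> poly_growth \<Theta> (partials (UNIV \<times> \<Theta>) vs f))"

text \<open>The Euclidean norm of the array of all \<open>k\<close>-th order partial derivatives of \<open>f\<close> at \<open>x\<close>.\<close>

definition deriv_norm ::
  "nat \<Rightarrow> ('v :: euclidean_space \<Rightarrow> 'b :: real_normed_vector) \<Rightarrow> 'v \<Rightarrow> real" where
  "deriv_norm k f x =
     sqrt (\<Sum>vs | set vs \<subseteq> Basis \<and> length vs = k. (norm (partials UNIV vs f x))\<^sup>2)"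

definition linear_growth ::
  "('v :: euclidean_space \<Rightarrow> 'b :: real_normed_vector) \<Rightarrow> bool" where
  "linear_growth f \<longleftrightarrow>
     (\<exists>C>0. \<forall>x. norm (f x) + deriv_norm 1 f x + deriv_norm 2 f x \<le> C * (1 + norm x))"

definition regular_coefficients ::
  "(real ^ 'm1) set \<Rightarrow> (real ^ 'm2) set \<Rightarrow>
   (real ^ 'd \<Rightarrow> real ^ 'm2 \<Rightarrow> real ^ 'd) \<Rightarrow>
   (real ^ 'd \<Rightarrow> real ^ 'm1 \<Rightarrow> real ^ 'r ^ 'd) \<Rightarrow>
   real ^ 'm1 \<Rightarrow> real ^ 'm2 \<Rightarrow> bool" where
  "regular_coefficients \<Theta>1 \<Theta>2 b a \<alpha> \<beta> \<longleftrightarrow>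
     (\<forall>i. smooth_coeff \<Theta>2 (\<lambda>(x, \<theta>). b x \<theta> $ i)) \<and>
     (\<forall>i j. smooth_coeff \<Theta>1 (\<lambda>(x, \<theta>). a x \<theta> $ i $ j)) \<and>
     linear_growth (\<lambda>x. b x \<beta>) \<and> linear_growth (\<lambda>x. a x \<alpha>)"


section \<open>Convergence in probability\<close>

text \<open>Measurability is part of the definition, since \<open>measure M A = 0\<close> for non-measurable \<open>A\<close>.\<close>

definition conv_in_prob ::
  "'a measure \<Rightarrow> ('i \<Rightarrow> 'a \<Rightarrow> 'b :: euclidean_space) \<Rightarrow> ('a \<Rightarrow> 'b) \<Rightarrow> 'i filter \<Rightarrow> bool" where
  "conv_in_prob M U V G \<longleftrightarrow>
     (\<forall>i. U i \<in> borel_measurable M) \<and> V \<in> borel_measurable M \<and>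
     (\<forall>\<delta>>0. ((\<lambda>i. measure M {\<omega> \<in> space M. dist (U i \<omega>) (V \<omega>) > \<delta>}) \<longlongrightarrow> 0) G)"


section \<open>Wiener processes\<close>

text \<open>
  Time runs through \<open>{0..}\<close>; values of processes and filtrations at negative times play no role.
\<close>

definition generated_by :: "'a measure \<Rightarrow> ('a \<Rightarrow> 'b :: topological_space) \<Rightarrow> 'a set set" where
  "generated_by M U = sets (vimage_algebra (space M) U borel)"

definition wiener_wrt ::
  "'a measure \<Rightarrow> (real \<Rightarrow> 'a measure) \<Rightarrow> (real \<Rightarrow> 'a \<Rightarrow> real ^ 'r) \<Rightarrow> bool" where
  "wiener_wrt M F w \<longleftrightarrow>
     filtration (space M) F \<and> (\<forall>t. subalgebra M (F t)) \<and>
     (\<forall>t\<ge>0. w t \<in> borel_measurable (F t)) \<and>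
     (AE \<omega> in M. w 0 \<omega> = 0) \<and>
     (\<forall>\<omega>\<in>space M. continuous_on {0..} (\<lambda>t. w t \<omega>)) \<and>
     (\<forall>s t. 0 \<le> s \<and> s < t \<longrightarrow>
        distributed M lborel (\<lambda>\<omega>. w t \<omega> - w s \<omega>)
          (\<lambda>x. ennreal (\<Prod>j\<in>UNIV. normal_density 0 (sqrt (t - s)) (x $ j))) \<and>
        prob_space.indep_set M (sets (F s)) (generated_by M (\<lambda>\<omega>. w t \<omega> - w s \<omega>)))"

definition natural_filtration ::
  "'a measure \<Rightarrow> (real \<Rightarrow> 'a \<Rightarrow> 'b :: topological_space) \<Rightarrow> real \<Rightarrow> 'a measure" where
  "natural_filtration M w t = sigma (space M) (\<Union>s\<in>{0..t}. generated_by M (w s))"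

definition standard_wiener :: "'a measure \<Rightarrow> (real \<Rightarrow> 'a \<Rightarrow> real ^ 'r) \<Rightarrow> bool" where
  "standard_wiener M w \<longleftrightarrow> wiener_wrt M (natural_filtration M w) w"


section \<open>The Ito integral\<close>

text \<open>
  A simple integrand takes the value \<open>\<xi> i\<close> on the time interval \<open>(\<tau> i, \<tau> (i + 1)]\<close> for \<open>i < m\<close>,
  where \<open>\<xi> i\<close> is bounded and known at time \<open>\<tau> i\<close>, and vanishes elsewhere.
\<close>

definition simple_integrand ::
  "'a measure \<Rightarrow> (real \<Rightarrow> 'a measure) \<Rightarrow> nat \<Rightarrow> (nat \<Rightarrow> real) \<Rightarrow> (nat \<Rightarrow> 'a \<Rightarrow> real) \<Rightarrow> bool" where
  "simple_integrand M F m \<tau> \<xi> \<longleftrightarrow>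
     0 \<le> \<tau> 0 \<and> (\<forall>i<m. \<tau> i \<le> \<tau> (Suc i)) \<and>
     (\<forall>i<m. \<xi> i \<in> borel_measurable (F (\<tau> i)) \<and> (\<exists>B. \<forall>\<omega>\<in>space M. \<bar>\<xi> i \<omega>\<bar> \<le> B))"

definition simple_process ::
  "nat \<Rightarrow> (nat \<Rightarrow> real) \<Rightarrow> (nat \<Rightarrow> 'a \<Rightarrow> real) \<Rightarrow> real \<Rightarrow> 'a \<Rightarrow> real" where
  "simple_process m \<tau> \<xi> s \<omega> = (\<Sum>i<m. \<xi> i \<omega> * indicator {\<tau> i<..\<tau> (Suc i)} s)"

definition simple_integral ::
  "nat \<Rightarrow> (nat \<Rightarrow> real) \<Rightarrow> (nat \<Rightarrow> 'a \<Rightarrow> real) \<Rightarrow> (real \<Rightarrow> 'a \<Rightarrow> real) \<Rightarrow> real \<Rightarrow> 'a \<Rightarrow> real" where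
  "simple_integral m \<tau> \<xi> W t \<omega> =
     (\<Sum>i<m. \<xi> i \<omega> * (W (min t (\<tau> (Suc i))) \<omega> - W (min t (\<tau> i)) \<omega>))"

definition progressive :: "(real \<Rightarrow> 'a measure) \<Rightarrow> (real \<Rightarrow> 'a \<Rightarrow> real) \<Rightarrow> bool" where
  "progressive F H \<longleftrightarrow>
     (\<forall>t\<ge>0. (\<lambda>(s, \<omega>). H s \<omega>) \<in> borel_measurable (restrict_space borel {0..t} \<Otimes>\<^sub>M F t))"

text \<open>
  \<open>J t\<close> is (a version of) the integral of \<open>H\<close> against the real Wiener process \<open>W\<close> over \<open>[0, t]\<close>:
  \<open>H\<close> is progressively measurable with locally square-integrable paths, and \<open>J\<close> is the limit in
  probability of the integrals of simple processes approximating \<open>H\<close>.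
\<close>

definition is_ito_integral ::
  "'a measure \<Rightarrow> (real \<Rightarrow> 'a measure) \<Rightarrow> (real \<Rightarrow> 'a \<Rightarrow> real) \<Rightarrow> (real \<Rightarrow> 'a \<Rightarrow> real) \<Rightarrow>
   (real \<Rightarrow> 'a \<Rightarrow> real) \<Rightarrow> bool" where
  "is_ito_integral M F W H J \<longleftrightarrow>
     progressive F H \<and>
     (AE \<omega> in M. \<forall>t\<ge>0. set_integrable lborel {0..t} (\<lambda>s. (H s \<omega>)\<^sup>2)) \<and>
     (\<exists>m \<tau> \<xi>.
        (\<forall>k::nat. simple_integrand M F (m k) (\<tau> k) (\<xi> k)) \<and>
        (\<forall>t\<ge>0.
           conv_in_prob M
             (\<lambda>k \<omega>. LINT s:{0..t}|lborel. (simple_process (m k) (\<tau> k) (\<xi> k) s \<omega> - H s \<omega>)\<^sup>2)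
             (\<lambda>\<omega>. 0) sequentially \<and>
           conv_in_prob M (\<lambda>k. simple_integral (m k) (\<tau> k) (\<xi> k) W t) (J t) sequentially))"


section \<open>Stochastic differential equations\<close>

text \<open>
  \<open>X\<close> is a continuous solution of \<open>dX = b(X) dt + a(X) dw\<close>, \<open>X\<^sub>0 = x0\<close>, relative to some filtration
  for which \<open>w\<close> is a Wiener process.
\<close>

definition sde_solution ::
  "'a measure \<Rightarrow> (real \<Rightarrow> 'a \<Rightarrow> real ^ 'r) \<Rightarrow> (real ^ 'd \<Rightarrow> real ^ 'd) \<Rightarrow>
   (real ^ 'd \<Rightarrow> real ^ 'r ^ 'd) \<Rightarrow> ('a \<Rightarrow> real ^ 'd) \<Rightarrow> (real \<Rightarrow> 'a \<Rightarrow> real ^ 'd) \<Rightarrow> bool" where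
  "sde_solution M w b a x0 X \<longleftrightarrow>
     (\<exists>F J.
        wiener_wrt M F w \<and> x0 \<in> borel_measurable (F 0) \<and>
        (\<forall>t\<ge>0. X t \<in> borel_measurable (F t)) \<and>
        (\<forall>\<omega>\<in>space M. continuous_on {0..} (\<lambda>t. X t \<omega>)) \<and>
        (\<forall>i j. is_ito_integral M F (\<lambda>s \<omega>. w s \<omega> $ j) (\<lambda>s \<omega>. a (X s \<omega>) $ i $ j) (J i j)) \<and>
        (\<forall>t\<ge>0. AE \<omega> in M.
           set_integrable lborel {0..t} (\<lambda>s. b (X s \<omega>)) \<and>
           X t \<omega> = x0 \<omega> + (LINT s:{0..t}|lborel. b (X s \<omega>)) + (\<chi> i. \<Sum>j\<in>UNIV. J i j t \<omega>)))"

text \<open>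
  \<open>\<nu>\<close> is an invariant law: \<open>\<nu> P\<^sub>t = \<nu>\<close> for the transition function \<open>P\<^sub>t(x, A) = P(Z\<^sub>t \<in> A)\<close>, where
  \<open>Z\<close> solves the equation with initial value \<open>x\<close>.
\<close>

definition invariant_law ::
  "'a measure \<Rightarrow> (real \<Rightarrow> 'a \<Rightarrow> real ^ 'r) \<Rightarrow> (real ^ 'd \<Rightarrow> real ^ 'd) \<Rightarrow>
   (real ^ 'd \<Rightarrow> real ^ 'r ^ 'd) \<Rightarrow> (real ^ 'd) measure \<Rightarrow> bool" where
  "invariant_law M w b a \<nu> \<longleftrightarrow>
     prob_space \<nu> \<and> sets \<nu> = sets borel \<and>
     (\<exists>Z. (\<forall>x. sde_solution M w b a (\<lambda>\<omega>. x) (Z x)) \<and>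
        (\<forall>t\<ge>0. \<forall>A\<in>sets borel.
           (\<lambda>x. measure M {\<omega> \<in> space M. Z x t \<omega> \<in> A}) \<in> borel_measurable borel \<and>
           (\<integral>x. measure M {\<omega> \<in> space M. Z x t \<omega> \<in> A} \<partial>\<nu>) = measure \<nu> A))"

definition ergodic_with ::
  "'a measure \<Rightarrow> (real \<Rightarrow> 'a \<Rightarrow> real ^ 'r) \<Rightarrow> (real ^ 'd \<Rightarrow> real ^ 'd) \<Rightarrow>
   (real ^ 'd \<Rightarrow> real ^ 'r ^ 'd) \<Rightarrow> (real \<Rightarrow> 'a \<Rightarrow> real ^ 'd) \<Rightarrow> (real ^ 'd) measure \<Rightarrow> bool" where
  "ergodic_with M w b a X \<nu> \<longleftrightarrow>
     invariant_law M w b a \<nu> \<and>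
     (\<forall>f :: real ^ 'd \<Rightarrow> real. f \<in> borel_measurable borel \<and> bounded (range f) \<longrightarrow>
        conv_in_prob M (\<lambda>T \<omega>. (1 / T) * (LINT t:{0..T}|lborel. f (X t \<omega>)))
          (\<lambda>\<omega>. \<integral>x. f x \<partial>\<nu>) at_top)"


section \<open>Noise and observations\<close>

datatype 'd source = Noise nat 'd | Driver | Initial

primrec source_sets ::
  "'a measure \<Rightarrow> (real \<Rightarrow> 'a \<Rightarrow> real ^ 'r) \<Rightarrow> ('a \<Rightarrow> real ^ 'd) \<Rightarrow> (nat \<Rightarrow> 'a \<Rightarrow> real ^ 'd) \<Rightarrow>
   'd source \<Rightarrow> 'a set set" where
  "source_sets M w x0 e (Noise i j) = generated_by M (\<lambda>\<omega>. e i \<omega> $ j)"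
| "source_sets M w x0 e Driver = sigma_sets (space M) (\<Union>t\<in>{0..}. generated_by M (w t))"
| "source_sets M w x0 e Initial = generated_by M x0"

text \<open>
  \<open>\<epsilon> n i\<close> is the noise at time \<open>i * h n\<close>, for \<open>i \<le> n\<close>.  For fixed \<open>n\<close>, the components of
  \<open>\<epsilon> n 0, \<dots>, \<epsilon> n n\<close>, the path of \<open>w\<close> and \<open>x0\<close> are mutually independent; the law of \<open>\<epsilon> n i\<close> depends
  neither on \<open>i\<close> nor on \<open>n\<close>; nothing is assumed about the joint law for different \<open>n\<close>.
\<close>

definition iid_standard_noise ::
  "'a measure \<Rightarrow> (real \<Rightarrow> 'a \<Rightarrow> real ^ 'r) \<Rightarrow> ('a \<Rightarrow> real ^ 'd) \<Rightarrow>
   (nat \<Rightarrow> nat \<Rightarrow> 'a \<Rightarrow> real ^ 'd) \<Rightarrow> bool" where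
  "iid_standard_noise M w x0 \<epsilon> \<longleftrightarrow>
     (\<forall>n. \<forall>i\<le>n. \<epsilon> n i \<in> borel_measurable M) \<and>
     (\<forall>n n'. \<forall>i\<le>n. \<forall>i'\<le>n'. distr M borel (\<epsilon> n i) = distr M borel (\<epsilon> n' i')) \<and>
     (\<forall>n. prob_space.indep_sets M (source_sets M w x0 (\<epsilon> n))
            ({Driver, Initial} \<union> {Noise i j |i j. i \<le> n})) \<and>
     (\<forall>n. \<forall>i\<le>n.
        integrable M (\<epsilon> n i) \<and> (\<integral>\<omega>. \<epsilon> n i \<omega> \<partial>M) = 0 \<and>
        integrable M (\<lambda>\<omega>. outer (\<epsilon> n i \<omega>)) \<and> (\<integral>\<omega>. outer (\<epsilon> n i \<omega>) \<partial>M) = mat 1)"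

definition observation ::
  "(real \<Rightarrow> 'a \<Rightarrow> real ^ 'd) \<Rightarrow> real ^ 'd ^ 'd \<Rightarrow> (nat \<Rightarrow> nat \<Rightarrow> 'a \<Rightarrow> real ^ 'd) \<Rightarrow> (nat \<Rightarrow> real) \<Rightarrow>
   nat \<Rightarrow> nat \<Rightarrow> 'a \<Rightarrow> real ^ 'd" where
  "observation X S \<epsilon> h n i \<omega> = X (real i * h n) \<omega> + S *v \<epsilon> n i \<omega>"

definition noise_cov_estimator ::
  "(nat \<Rightarrow> nat \<Rightarrow> 'a \<Rightarrow> real ^ 'd) \<Rightarrow> nat \<Rightarrow> 'a \<Rightarrow> real ^ 'd ^ 'd" where
  "noise_cov_estimator Y n \<omega> =
     (1 / (2 * real n)) *\<^sub>R (\<Sum>i<n. outer (Y n (Suc i) \<omega> - Y n i \<omega>))"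

end

theory Submission
  imports Defs
begin

text \<open>
  Write \<open>\<Delta>Y = \<Delta>X + S \<Delta>\<epsilon>\<close>.  The increments of \<open>X\<close> over intervals of length \<open>h\<close> tend to \<open>0\<close> in \<open>L\<^sup>2\<close>,
  uniformly in time: the Ito isometry for simple integrands, combined with a truncation, bounds the tail
  of an Ito integral by that of its quadratic variation, which has mean of order \<open>h\<close>; bounded fourth
  moments then turn smallness in probability into smallness in \<open>L\<^sup>2\<close>.  So \<open>\<Delta>X\<close> contributes nothing to
  the limit, and neither do the cross terms, by the AM-GM inequality.  What remains is \<open>S\<close> times
  the empirical covariance of \<open>\<Delta>\<epsilon>\<close> times \<open>S\<close>; its summands are one-dependent with mean \<open>2 I\<close>, so its
  variance is of order \<open>1 / n\<close>.
\<close>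

text \<open>The obstacle is that \<open>is_ito_integral\<close> describes a stochastic integral only
  as a limit in probability of simple integrals: it supplies no isometry and no moment of
  \<open>J\<close>, and the approximants may have second moments that do not converge. Tail
  estimates survive such a limit, moments need not. Hence the increments of \<open>X\<close> are
  estimated in probability, and moments enter only through \<open>X\<close> itself, by (A3), and
  through the noise, by (A4). A second constraint is that the observation window n h_n grows without
  bound, so estimates that are uniform only over bounded time intervals would not do. The step
  \<open>r\<close> below which increments are small therefore has to depend on the dimensions, the
  growth constant and the moment bound alone, never on the starting time \<open>s\<close>. Errors
  are compared entry by entry in L1, where they simply add up.\<close>

lemma borel_measurable_vec_nth [measurable (raw)]:
  fixes f :: "'a \<Rightarrow> real ^ 'n"
  shows "f \<in> borel_measurable M \<Longrightarrow> (\<lambda>x. f x $ j) \<in> borel_measurable M"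
  by (rule borel_measurable_continuous_on[of "\<lambda>x. x $ j"]) (auto intro!: continuous_intros)

section \<open>Scalar Wiener processes and discrete stochastic sums\<close>

text \<open>The marginal of a product density: Lebesgue measure on R^r factors over the basis, the
  indicator of \<open>A\<close> concerns only the coordinate \<open>j\<close>, and every other
  factor integrates to 1. It passes from the joint Gaussian density in \<open>wiener_wrt\<close> to
  one coordinate.\<close>

lemma (in prob_space) distributed_component:
  fixes U :: "'a \<Rightarrow> real ^ 'r"
  assumes U: "distributed M lborel U (\<lambda>x. ennreal (\<Prod>j\<in>UNIV. f (x $ j)))"
    and f [measurable]: "f \<in> borel_measurable borel"
    and nn: "\<And>x. 0 \<le> f x" and one: "(\<integral>\<^sup>+x. ennreal (f x) \<partial>lborel) = 1"
  shows "distributed M lborel (\<lambda>\<omega>. U \<omega> $ j) (\<lambda>x. ennreal (f x))"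
  unfolding distributed_def
proof (intro conjI)
  have [measurable]: "U \<in> borel_measurable M"
    using distributed_measurable[OF U] by simp
  show "random_variable lborel (\<lambda>\<omega>. U \<omega> $ j)"
    unfolding measurable_lborel1
    by measurable
  show "(\<lambda>x. ennreal (f x)) \<in> borel_measurable lborel"
    by simp
  show "distr M lborel (\<lambda>\<omega>. U \<omega> $ j) = density lborel (\<lambda>x. ennreal (f x))"
  proof (rule measure_eqI)
    fix A assume "A \<in> sets (distr M lborel (\<lambda>\<omega>. U \<omega> $ j))"
    then have [measurable]: "A \<in> sets borel"
      by simp
    let ?g = "\<lambda>(b :: real ^ 'r) x. ennreal (f x) * (if b = axis j 1 then indicator A x else 1)"
    \<comment> \<open>\<open>nn_integral_lborel_prod\<close> speaks of products over
      \<open>Basis\<close>; reindexing by \<open>axis k 1\<close> turns them into products over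
      coordinates.\<close>
    have B: "prod g (Basis :: (real ^ 'r) set) = (\<Prod>k\<in>UNIV. g (axis k 1))" for g :: "real ^ 'r \<Rightarrow> ennreal"
      by (subst prod.reindex[symmetric, of "\<lambda>k. axis k 1", unfolded comp_def])
         (auto simp: inj_def axis_eq_axis Basis_vec_def intro!: prod.cong)
    have "emeasure (distr M lborel (\<lambda>\<omega>. U \<omega> $ j)) A = emeasure M (U -` {x. x $ j \<in> A} \<inter> space M)"
      by (subst emeasure_distr) (auto intro!: arg_cong[where f="emeasure M"])
    also have "\<dots> = (\<integral>\<^sup>+x. ennreal (\<Prod>j\<in>UNIV. f (x $ j)) * indicator {x. x $ j \<in> A} x \<partial>lborel)"
      by (rule distributed_emeasure[OF U]) simp
    also have "\<dots> = (\<integral>\<^sup>+x. (\<Prod>b\<in>Basis. ?g b (x \<bullet> b)) \<partial>lborel)"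
    proof (rule nn_integral_cong)
      fix x :: "real ^ 'r"
      have "(\<Prod>b\<in>Basis. ?g b (x \<bullet> b)) =
          (\<Prod>k\<in>UNIV. ennreal (f (x $ k))) * (\<Prod>k\<in>UNIV. if k = j then indicator A (x $ k) else 1)"
        unfolding B by (simp add: prod.distrib axis_eq_axis inner_axis)
      also have "(\<Prod>k\<in>UNIV. if k = j then indicator A (x $ k) else 1) = (indicator A (x $ j) :: ennreal)"
        by simp
      finally show "ennreal (\<Prod>j\<in>UNIV. f (x $ j)) * indicator {x. x $ j \<in> A} x =
          (\<Prod>b\<in>Basis. ?g b (x \<bullet> b))"
        by (simp add: prod_ennreal nn indicator_def)
    qed
    also have "\<dots> = (\<Prod>b\<in>Basis. \<integral>\<^sup>+x. ?g b x \<partial>lborel)"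
      by (rule nn_integral_lborel_prod) (auto simp: nn)
    also have "\<dots> = (\<Prod>k\<in>UNIV. if k = j then \<integral>\<^sup>+x. ennreal (f x) * indicator A x \<partial>lborel else 1)"
      unfolding B by (rule prod.cong) (auto simp: axis_eq_axis one)
    also have "\<dots> = (\<integral>\<^sup>+x. ennreal (f x) * indicator A x \<partial>lborel)"
      by simp
    finally show "emeasure (distr M lborel (\<lambda>\<omega>. U \<omega> $ j)) A = emeasure (density lborel (\<lambda>x. ennreal (f x))) A"
      by (simp add: emeasure_density)
  qed simp
qed

text \<open>One coordinate of the driving process. The filtration is a parameter because the
  solution is adapted to some \<open>F\<close> that may be larger than the natural filtration of
  \<open>w\<close>; increments must be independent of all of \<open>F s\<close>, since the
  integrands are known only relative to \<open>F\<close>.\<close>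

locale real_wiener = prob_space M for M :: "'a measure" +
  fixes F :: "real \<Rightarrow> 'a measure" and W :: "real \<Rightarrow> 'a \<Rightarrow> real"
  assumes filtration: "filtration (space M) F"
    and subalg: "subalgebra M (F t)"
    and adapted: "0 \<le> t \<Longrightarrow> W t \<in> borel_measurable (F t)"
    and normal_increment: "0 \<le> s \<Longrightarrow> s < t \<Longrightarrow>
      distributed M lborel (\<lambda>\<omega>. W t \<omega> - W s \<omega>) (\<lambda>x. ennreal (normal_density 0 (sqrt (t - s)) x))"
    and indep_increment: "0 \<le> s \<Longrightarrow> s < t \<Longrightarrow>
      indep_set (sets (F s)) (generated_by M (\<lambda>\<omega>. W t \<omega> - W s \<omega>))"
begin

lemma measurable_F_mono: "f \<in> borel_measurable (F s) \<Longrightarrow> s \<le> t \<Longrightarrow> f \<in> borel_measurable (F t)"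
  using filtration measurable_mono[of borel borel "F s" "F t"]
  by (auto simp: filtration_def)

lemma measurable_F: "f \<in> borel_measurable (F s) \<Longrightarrow> f \<in> borel_measurable M"
  using subalg measurable_from_subalg by blast

lemma measurable_W [measurable]: "0 \<le> t \<Longrightarrow> W t \<in> borel_measurable M"
  by (rule measurable_F[OF adapted])

lemma increment_moments:
  assumes "0 \<le> s" "s \<le> t"
  shows "integrable M (\<lambda>\<omega>. W t \<omega> - W s \<omega>)" "expectation (\<lambda>\<omega>. W t \<omega> - W s \<omega>) = 0"
    "integrable M (\<lambda>\<omega>. (W t \<omega> - W s \<omega>)\<^sup>2)" "expectation (\<lambda>\<omega>. (W t \<omega> - W s \<omega>)\<^sup>2) = t - s"
proof -
  have "integrable M (\<lambda>\<omega>. W t \<omega> - W s \<omega>) \<and> expectation (\<lambda>\<omega>. W t \<omega> - W s \<omega>) = 0 \<and>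
    integrable M (\<lambda>\<omega>. (W t \<omega> - W s \<omega>)\<^sup>2) \<and> expectation (\<lambda>\<omega>. (W t \<omega> - W s \<omega>)\<^sup>2) = t - s"
  proof (cases "s = t")
    case False
    with assms have st: "s < t" "0 < sqrt (t - s)"
      by auto
    note D = normal_increment[OF assms(1) st(1)]
    have 1: "integrable M (\<lambda>\<omega>. W t \<omega> - W s \<omega>)"
      by (subst distributed_integrable[OF D, of "\<lambda>x. x", symmetric])
         (auto simp: integrable_normal_moment_nz_1[OF st(2)])
    have 2: "expectation (\<lambda>\<omega>. W t \<omega> - W s \<omega>) = 0"
      by (rule normal_distributed_expectation[OF st(2) D])
    have 3: "integrable M (\<lambda>\<omega>. (W t \<omega> - W s \<omega>)\<^sup>2)"
      using integrable_normal_moment[OF st(2), of 0 2]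
      by (subst distributed_integrable[OF D, of "\<lambda>x. x\<^sup>2", symmetric]) auto
    have "variance (\<lambda>\<omega>. W t \<omega> - W s \<omega>) = (sqrt (t - s))\<^sup>2"
      by (rule normal_distributed_variance[OF st(2) D])
    then show ?thesis
      using 1 2 3 st by simp
  qed simp
  then show "integrable M (\<lambda>\<omega>. W t \<omega> - W s \<omega>)" "expectation (\<lambda>\<omega>. W t \<omega> - W s \<omega>) = 0"
    "integrable M (\<lambda>\<omega>. (W t \<omega> - W s \<omega>)\<^sup>2)" "expectation (\<lambda>\<omega>. (W t \<omega> - W s \<omega>)\<^sup>2) = t - s"
    by auto
qed

lemma indep_var_increment:
  assumes "0 \<le> s" "s < t" and g: "g \<in> borel_measurable (F s)"
  shows "indep_var borel g borel (\<lambda>\<omega>. W t \<omega> - W s \<omega>)"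
proof -
  let ?D = "\<lambda>\<omega>. W t \<omega> - W s \<omega>"
  have [measurable]: "g \<in> borel_measurable M" "?D \<in> borel_measurable M"
    using assms measurable_F by auto
  have sp: "space (F s) = space M"
    using filtration by (simp add: filtration_def)
  have 1: "sigma_sets (space M) {g -` A \<inter> space M | A. A \<in> sets borel} \<subseteq> sets (F s)"
    unfolding sp[symmetric] by (rule sets.sigma_sets_subset) (use g in auto)
  have 2: "sigma_sets (space M) {?D -` A \<inter> space M | A. A \<in> sets borel} = generated_by M ?D"
    by (simp add: generated_by_def sets_vimage_algebra)
  show ?thesis
    using indep_increment[OF assms(1,2)] 1 unfolding indep_var_eq 2
    by (auto simp: indep_sets2_eq)
qed

text \<open>Independence makes the products integrable and factors their expectations, so
  \<open>g\<close> itself need only be integrable. The isometry applies this with \<open>g\<close> =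
  \<open>S k * \<eta> k\<close> for the cross term and with \<open>g\<close> the square of
  \<open>\<eta> k\<close> for the diagonal term.\<close>

lemma expectation_mult_increment:
  assumes "0 \<le> s" "s \<le> t" and g: "g \<in> borel_measurable (F s)" "integrable M g"
  shows "integrable M (\<lambda>\<omega>. g \<omega> * (W t \<omega> - W s \<omega>))"
    and "expectation (\<lambda>\<omega>. g \<omega> * (W t \<omega> - W s \<omega>)) = 0"
    and "integrable M (\<lambda>\<omega>. g \<omega> * (W t \<omega> - W s \<omega>)\<^sup>2)"
    and "expectation (\<lambda>\<omega>. g \<omega> * (W t \<omega> - W s \<omega>)\<^sup>2) = expectation g * (t - s)"
proof -
  have "integrable M (\<lambda>\<omega>. g \<omega> * (W t \<omega> - W s \<omega>)) \<and>
    expectation (\<lambda>\<omega>. g \<omega> * (W t \<omega> - W s \<omega>)) = 0 \<and>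
    integrable M (\<lambda>\<omega>. g \<omega> * (W t \<omega> - W s \<omega>)\<^sup>2) \<and>
    expectation (\<lambda>\<omega>. g \<omega> * (W t \<omega> - W s \<omega>)\<^sup>2) = expectation g * (t - s)"
  proof (cases "s = t")
    case False
    then have "s < t" using assms by simp
    note I = indep_var_increment[OF assms(1) this g(1)]
    have I2: "indep_var borel g borel (\<lambda>\<omega>. (W t \<omega> - W s \<omega>)\<^sup>2)"
      using indep_var_compose[OF I, of "\<lambda>x. x" borel "\<lambda>x. x\<^sup>2" borel] by (simp add: comp_def)
    note m = increment_moments[OF assms(1,2)]
    show ?thesis
      using indep_var_lebesgue_integral[OF I g(2) m(1)] indep_var_integrable[OF I g(2) m(1)]
        indep_var_lebesgue_integral[OF I2 g(2) m(3)] indep_var_integrable[OF I2 g(2) m(3)] m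
      by simp
  qed simp
  then show "integrable M (\<lambda>\<omega>. g \<omega> * (W t \<omega> - W s \<omega>))"
    "expectation (\<lambda>\<omega>. g \<omega> * (W t \<omega> - W s \<omega>)) = 0"
    "integrable M (\<lambda>\<omega>. g \<omega> * (W t \<omega> - W s \<omega>)\<^sup>2)"
    "expectation (\<lambda>\<omega>. g \<omega> * (W t \<omega> - W s \<omega>)\<^sup>2) = expectation g * (t - s)"
    by auto
qed

text \<open>Orthogonality of increments, by induction on the number of summands: in the square of
  \<open>S (Suc k)\<close> the cross term has mean 0 because \<open>S k * \<eta> k\<close> is known
  at time \<open>c k\<close>. The induction therefore also carries the adaptedness and square
  integrability of \<open>S k\<close>.\<close>

lemma ito_isometry_sum:
  fixes c :: "nat \<Rightarrow> real" and \<eta> :: "nat \<Rightarrow> 'a \<Rightarrow> real"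
  assumes c: "0 \<le> c 0" "\<And>i. i < m \<Longrightarrow> c i \<le> c (Suc i)"
    and \<eta>: "\<And>i. i < m \<Longrightarrow> \<eta> i \<in> borel_measurable (F (c i))"
    and bdd: "\<And>i. i < m \<Longrightarrow> \<exists>B. \<forall>\<omega>\<in>space M. \<bar>\<eta> i \<omega>\<bar> \<le> B"
  defines "S \<equiv> \<lambda>k \<omega>. \<Sum>i<k. \<eta> i \<omega> * (W (c (Suc i)) \<omega> - W (c i) \<omega>)"
  shows "integrable M (\<lambda>\<omega>. (S m \<omega>)\<^sup>2)"
    and "expectation (\<lambda>\<omega>. (S m \<omega>)\<^sup>2) = (\<Sum>i<m. expectation (\<lambda>\<omega>. (\<eta> i \<omega>)\<^sup>2) * (c (Suc i) - c i))"
proof -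
  have "k \<le> m \<Longrightarrow> 0 \<le> c k \<and> S k \<in> borel_measurable (F (c k)) \<and> integrable M (\<lambda>\<omega>. (S k \<omega>)\<^sup>2) \<and>
    expectation (\<lambda>\<omega>. (S k \<omega>)\<^sup>2) = (\<Sum>i<k. expectation (\<lambda>\<omega>. (\<eta> i \<omega>)\<^sup>2) * (c (Suc i) - c i))" for k
  proof (induction k)
    case 0
    then show ?case using c by (simp add: S_def)
  next
    case (Suc k)
    let ?D = "\<lambda>\<omega>. W (c (Suc k)) \<omega> - W (c k) \<omega>"
    from Suc have IH: "0 \<le> c k" "S k \<in> borel_measurable (F (c k))" "integrable M (\<lambda>\<omega>. (S k \<omega>)\<^sup>2)"
      "expectation (\<lambda>\<omega>. (S k \<omega>)\<^sup>2) = (\<Sum>i<k. expectation (\<lambda>\<omega>. (\<eta> i \<omega>)\<^sup>2) * (c (Suc i) - c i))"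
      and k: "k < m"
      by auto
    note ck = c(2)[OF k]
    obtain B where B: "\<And>\<omega>. \<omega> \<in> space M \<Longrightarrow> \<bar>\<eta> k \<omega>\<bar> \<le> B"
      using bdd[OF k] by blast
    have [measurable]: "S k \<in> borel_measurable M" "\<eta> k \<in> borel_measurable M"
      using IH(2) \<eta>[OF k] measurable_F by auto
    have i1: "integrable M (\<lambda>\<omega>. (\<eta> k \<omega>)\<^sup>2)"
      using B by (intro integrable_const_bound[where B="B\<^sup>2"] AE_I2)
        (auto simp: abs_le_square_iff[symmetric] intro: order_trans abs_ge_self)
    have i2: "integrable M (\<lambda>\<omega>. S k \<omega> * \<eta> k \<omega>)"
    proof (rule Bochner_Integration.integrable_bound)
      show "integrable M (\<lambda>\<omega>. (S k \<omega>)\<^sup>2 + (\<eta> k \<omega>)\<^sup>2)"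
        using i1 IH(3) by simp
      have "\<bar>x * y\<bar> \<le> x\<^sup>2 + y\<^sup>2" for x y :: real
        using sum_squares_bound[of "\<bar>x\<bar>" "\<bar>y\<bar>"]
          mult_nonneg_nonneg[of "\<bar>x\<bar>" "\<bar>y\<bar>"] unfolding abs_mult power2_abs by linarith
      then show "AE \<omega> in M. norm (S k \<omega> * \<eta> k \<omega>) \<le> norm ((S k \<omega>)\<^sup>2 + (\<eta> k \<omega>)\<^sup>2)"
        by simp
    qed simp
    have m1: "(\<lambda>\<omega>. S k \<omega> * \<eta> k \<omega>) \<in> borel_measurable (F (c k))"
      "(\<lambda>\<omega>. (\<eta> k \<omega>)\<^sup>2) \<in> borel_measurable (F (c k))"
      using IH(2) \<eta>[OF k] by auto
    note e1 = expectation_mult_increment[OF IH(1) ck m1(1) i2]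
    note e2 = expectation_mult_increment[OF IH(1) ck m1(2) i1]
    have S: "S (Suc k) = (\<lambda>\<omega>. S k \<omega> + \<eta> k \<omega> * ?D \<omega>)"
      by (simp add: S_def)
    have S2: "(\<lambda>\<omega>. (S (Suc k) \<omega>)\<^sup>2) =
        (\<lambda>\<omega>. (S k \<omega>)\<^sup>2 + 2 * (S k \<omega> * \<eta> k \<omega> * ?D \<omega>) + (\<eta> k \<omega>)\<^sup>2 * (?D \<omega>)\<^sup>2)"
      unfolding S by (simp add: power2_eq_square algebra_simps)
    have "S (Suc k) \<in> borel_measurable (F (c (Suc k)))"
      unfolding S using IH(1,2) \<eta>[OF k] ck adapted[of "c k"] adapted[of "c (Suc k)"]
      by (intro borel_measurable_add borel_measurable_times borel_measurable_diff)
         (auto intro: measurable_F_mono)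
    then show ?case
      unfolding S2 using e1 e2 IH ck by auto
  qed
  then show "integrable M (\<lambda>\<omega>. (S m \<omega>)\<^sup>2)"
    "expectation (\<lambda>\<omega>. (S m \<omega>)\<^sup>2) = (\<Sum>i<m. expectation (\<lambda>\<omega>. (\<eta> i \<omega>)\<^sup>2) * (c (Suc i) - c i))"
    by auto
qed

text \<open>
  The integrand is stopped just before its quadratic variation would exceed \<open>N\<close>; the variation over
  the next interval is already known at the start of that interval, so the stopped integrand is adapted.
\<close>

lemma sum_tail_bound:
  fixes c :: "nat \<Rightarrow> real" and \<xi> :: "nat \<Rightarrow> 'a \<Rightarrow> real"
  assumes c: "0 \<le> c 0" "\<And>i. i < m \<Longrightarrow> c i \<le> c (Suc i)"
    and \<xi>: "\<And>i. i < m \<Longrightarrow> \<xi> i \<in> borel_measurable (F (c i))"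
    and bdd: "\<And>i. i < m \<Longrightarrow> \<exists>B. \<forall>\<omega>\<in>space M. \<bar>\<xi> i \<omega>\<bar> \<le> B"
    and "0 < \<delta>" "0 \<le> N"
  shows "\<P>(\<omega> in M. (\<Sum>i<m. (\<xi> i \<omega>)\<^sup>2 * (c (Suc i) - c i)) \<le> N \<and>
      \<delta> < \<bar>\<Sum>i<m. \<xi> i \<omega> * (W (c (Suc i)) \<omega> - W (c i) \<omega>)\<bar>) \<le> N / \<delta>\<^sup>2"
proof -
  define Q where "Q k \<omega> = (\<Sum>i<k. (\<xi> i \<omega>)\<^sup>2 * (c (Suc i) - c i))" for k \<omega>
  define \<eta> where "\<eta> i \<omega> = (if Q (Suc i) \<omega> \<le> N then \<xi> i \<omega> else 0)" for i \<omega>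
  let ?S = "\<lambda>\<omega>. \<Sum>i<m. \<eta> i \<omega> * (W (c (Suc i)) \<omega> - W (c i) \<omega>)"
  have cmono: "c i \<le> c j" if "i \<le> j" "j \<le> m" for i j
    using that
  proof (induction rule: dec_induct)
    case (step n)
    then show ?case
      using c(2)[of n] by simp
  qed simp
  have c0: "0 \<le> c j" if "j \<le> m" for j
    using cmono[of 0 j] c that by auto
  have Qmono: "Q i \<omega> \<le> Q j \<omega>" if "i \<le> j" "j \<le> m" for i j \<omega>
    unfolding Q_def using that c(2) by (intro sum_mono2) auto
  have \<eta>_meas: "\<eta> i \<in> borel_measurable (F (c i))" if i: "i < m" for i
  proof -
    have [measurable]: "\<xi> j \<in> borel_measurable (F (c i))" if "j \<le> i" for j
      using measurable_F_mono[OF \<xi> cmono] that i by auto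
    have [measurable]: "Q (Suc i) \<in> borel_measurable (F (c i))"
      unfolding Q_def by measurable
    have [measurable]: "\<xi> i \<in> borel_measurable (F (c i))"
      using \<xi> i by simp
    show ?thesis
      unfolding \<eta>_def by measurable
  qed
  have \<eta>_bdd: "\<exists>B. \<forall>\<omega>\<in>space M. \<bar>\<eta> i \<omega>\<bar> \<le> B" if i: "i < m" for i
  proof -
    obtain B where "\<forall>\<omega>\<in>space M. \<bar>\<xi> i \<omega>\<bar> \<le> B"
      using bdd[OF i] by blast
    then have "\<forall>\<omega>\<in>space M. \<bar>\<eta> i \<omega>\<bar> \<le> max B 0"
      by (auto simp: \<eta>_def le_max_iff_disj)
    then show ?thesis by blast
  qed
  have Q\<eta>: "(\<Sum>i<k. (\<eta> i \<omega>)\<^sup>2 * (c (Suc i) - c i)) \<le> N" if "k \<le> m" for k \<omega>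
    using that
  proof (induction k)
    case (Suc k)
    show ?case
    \<comment> \<open>If the variation is still at most \<open>N\<close> after step
      \<open>k\<close>, monotonicity of \<open>Q\<close> shows that nothing has been cut so far and
      the sum is \<open>Q (Suc k)\<close>. Otherwise the last summand is 0 and the induction
      hypothesis suffices.\<close>
    proof (cases "Q (Suc k) \<omega> \<le> N")
      case True
      then have "\<eta> i \<omega> = \<xi> i \<omega>" if "i \<le> k" for i
        using Qmono[of "Suc i" "Suc k" \<omega>] that Suc.prems by (simp add: \<eta>_def)
      then have "(\<Sum>i<Suc k. (\<eta> i \<omega>)\<^sup>2 * (c (Suc i) - c i)) = Q (Suc k) \<omega>"
        unfolding Q_def by (intro sum.cong) auto
      with True show ?thesis by simp
    qed (use Suc in \<open>simp add: \<eta>_def\<close>)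
  qed (use \<open>0 \<le> N\<close> in simp)
  have [measurable]: "\<eta> i \<in> borel_measurable M" "\<xi> i \<in> borel_measurable M"
    "W (c i) \<in> borel_measurable M" "W (c (Suc i)) \<in> borel_measurable M" if "i < m" for i
    using \<eta>_meas \<xi> measurable_F that c0[of i] c0[of "Suc i"] by auto
  have S[measurable]: "?S \<in> borel_measurable M"
    by measurable
  have int\<eta>: "integrable M (\<lambda>\<omega>. (\<eta> i \<omega>)\<^sup>2)" if i: "i < m" for i
  proof -
    obtain B where B: "\<And>\<omega>. \<omega> \<in> space M \<Longrightarrow> \<bar>\<eta> i \<omega>\<bar> \<le> B"
      using \<eta>_bdd[OF i] by blast
    show ?thesis
      using B i by (intro integrable_const_bound[where B="B\<^sup>2"] AE_I2)
        (auto simp: abs_le_square_iff[symmetric] intro: order_trans abs_ge_self)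
  qed
  note iso = ito_isometry_sum[where c=c and \<eta>=\<eta> and m=m, OF c \<eta>_meas \<eta>_bdd]
  \<comment> \<open>The bound on the stopped variation holds for every path, so the second moment is
    at most \<open>N\<close> however large the bounds on the \<open>\<xi> i\<close> are.\<close>
  have "expectation (\<lambda>\<omega>. (?S \<omega>)\<^sup>2) = expectation (\<lambda>\<omega>. \<Sum>i<m. (\<eta> i \<omega>)\<^sup>2 * (c (Suc i) - c i))"
    using iso int\<eta> by simp
  also have "\<dots> \<le> N"
    using int\<eta> Q\<eta>[of m] by (intro integral_le_const AE_I2) auto
  finally have ES: "expectation (\<lambda>\<omega>. (?S \<omega>)\<^sup>2) \<le> N" .
  \<comment> \<open>On this event the total variation is at most \<open>N\<close>, so the stopped
    and the original sums agree and Chebyshev's inequality for the stopped one applies.\<close>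
  have "\<P>(\<omega> in M. (\<Sum>i<m. (\<xi> i \<omega>)\<^sup>2 * (c (Suc i) - c i)) \<le> N \<and>
      \<delta> < \<bar>\<Sum>i<m. \<xi> i \<omega> * (W (c (Suc i)) \<omega> - W (c i) \<omega>)\<bar>) \<le> \<P>(\<omega> in M. \<delta>\<^sup>2 \<le> (?S \<omega>)\<^sup>2)"
  proof (rule finite_measure_mono)
    show "{\<omega>\<in>space M. (\<Sum>i<m. (\<xi> i \<omega>)\<^sup>2 * (c (Suc i) - c i)) \<le> N \<and>
        \<delta> < \<bar>\<Sum>i<m. \<xi> i \<omega> * (W (c (Suc i)) \<omega> - W (c i) \<omega>)\<bar>} \<subseteq> {\<omega>\<in>space M. \<delta>\<^sup>2 \<le> (?S \<omega>)\<^sup>2}"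
    proof safe
      fix \<omega>
      assume Q: "(\<Sum>i<m. (\<xi> i \<omega>)\<^sup>2 * (c (Suc i) - c i)) \<le> N"
        and lt: "\<delta> < \<bar>\<Sum>i<m. \<xi> i \<omega> * (W (c (Suc i)) \<omega> - W (c i) \<omega>)\<bar>"
      have "\<eta> i \<omega> = \<xi> i \<omega>" if "i < m" for i
        using Qmono[of "Suc i" m \<omega>] that Q by (auto simp: \<eta>_def Q_def)
      then have "?S \<omega> = (\<Sum>i<m. \<xi> i \<omega> * (W (c (Suc i)) \<omega> - W (c i) \<omega>))"
        by (intro sum.cong) auto
      with lt \<open>0 < \<delta>\<close> show "\<delta>\<^sup>2 \<le> (?S \<omega>)\<^sup>2"
        by (simp add: abs_le_square_iff[symmetric])
    qed
  qed (use S in measurable)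
  also have "\<dots> \<le> expectation (\<lambda>\<omega>. (?S \<omega>)\<^sup>2) / \<delta>\<^sup>2"
    using iso \<open>0 < \<delta>\<close> by (intro integral_Markov_inequality_measure[where A="{}"]) auto
  also have "\<dots> \<le> N / \<delta>\<^sup>2"
    using ES by (intro divide_right_mono) auto
  finally show ?thesis .
qed

end

text \<open>The density of a coordinate increment is a marginal, and the sigma-algebra it generates
  lies inside that of the vector increment, so independence of \<open>F s\<close> is
  inherited.\<close>

lemma wiener_wrt_component:
  assumes "prob_space M" "wiener_wrt M F w"
  shows "real_wiener M F (\<lambda>t \<omega>. w t \<omega> $ j)"
proof -
  interpret prob_space M by fact
  show ?thesis
  proof (intro real_wiener.intro real_wiener_axioms.intro prob_space_axioms)
    show "filtration (space M) F"
      using assms by (auto simp: wiener_wrt_def)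
    show "subalgebra M (F t)" for t
      using assms by (auto simp: wiener_wrt_def)
    show "(\<lambda>\<omega>. w t \<omega> $ j) \<in> borel_measurable (F t)" if "0 \<le> t" for t
    proof -
      have [measurable]: "w t \<in> borel_measurable (F t)"
        using assms that by (auto simp: wiener_wrt_def)
      show ?thesis by measurable
    qed
    fix s t :: real assume st: "0 \<le> s" "s < t"
    have D: "distributed M lborel (\<lambda>\<omega>. w t \<omega> - w s \<omega>)
          (\<lambda>x. ennreal (\<Prod>j\<in>UNIV. normal_density 0 (sqrt (t - s)) (x $ j)))"
      and I: "indep_set (sets (F s)) (generated_by M (\<lambda>\<omega>. w t \<omega> - w s \<omega>))"
      using assms st by (auto simp: wiener_wrt_def)
    have "(\<integral>\<^sup>+x. ennreal (normal_density 0 (sqrt (t - s)) x) \<partial>lborel) = 1"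
      using st by (subst nn_integral_eq_integral) auto
    from distributed_component[OF D _ _ this, of j]
    show "distributed M lborel (\<lambda>\<omega>. w t \<omega> $ j - w s \<omega> $ j)
        (\<lambda>x. ennreal (normal_density 0 (sqrt (t - s)) x))"
      by simp
    have "generated_by M (\<lambda>\<omega>. w t \<omega> $ j - w s \<omega> $ j) \<subseteq> generated_by M (\<lambda>\<omega>. w t \<omega> - w s \<omega>)"
    proof
      fix B assume "B \<in> generated_by M (\<lambda>\<omega>. w t \<omega> $ j - w s \<omega> $ j)"
      then obtain A where [measurable]: "A \<in> sets borel"
        and B: "B = (\<lambda>\<omega>. w t \<omega> $ j - w s \<omega> $ j) -` A \<inter> space M"
        by (auto simp: generated_by_def sets_vimage_algebra2)
      have "{x::real^'b. x $ j \<in> A} \<in> sets borel"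
        by measurable
      moreover have "B = (\<lambda>\<omega>. w t \<omega> - w s \<omega>) -` {x. x $ j \<in> A} \<inter> space M"
        by (auto simp: B)
      ultimately show "B \<in> generated_by M (\<lambda>\<omega>. w t \<omega> - w s \<omega>)"
        unfolding generated_by_def by (subst sets_vimage_algebra2, simp, blast)
    qed
    with I show "indep_set (sets (F s)) (generated_by M (\<lambda>\<omega>. w t \<omega> $ j - w s \<omega> $ j))"
      by (auto simp: indep_sets2_eq)
  qed
qed

section \<open>Simple processes and tail bounds for Ito integrals\<close>

text \<open>The intervals of the partition are disjoint, so at any time at most one summand is
  nonzero and squaring produces no cross terms.\<close>

lemma simple_process_square:
  assumes "\<And>i. i < m \<Longrightarrow> \<tau> i \<le> \<tau> (Suc i)"
  shows "(simple_process m \<tau> \<xi> u \<omega>)\<^sup>2 = (\<Sum>i<m. (\<xi> i \<omega>)\<^sup>2 * indicator {\<tau> i<..\<tau> (Suc i)} u)"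
  using assms
proof (induction m)
  case (Suc m)
  have mono: "\<tau> i \<le> \<tau> j" if "i \<le> j" "j \<le> Suc m" for i j
    using that
  proof (induction rule: dec_induct)
    case (step n)
    then show ?case
      using Suc.prems[of n] by simp
  qed simp
  show ?case
  proof (cases "\<tau> m < u")
    case True
    have "u \<notin> {\<tau> i<..\<tau> (Suc i)}" if "i < m" for i
      using mono[of "Suc i" m] that True by auto
    then have "simple_process (Suc m) \<tau> \<xi> u \<omega> = \<xi> m \<omega> * indicator {\<tau> m<..\<tau> (Suc m)} u"
      "(\<Sum>i<m. (\<xi> i \<omega>)\<^sup>2 * indicator {\<tau> i<..\<tau> (Suc i)} u) = 0"
      by (auto simp: simple_process_def intro!: sum.neutral)
    then show ?thesis
      by (simp add: power_mult_distrib indicator_def)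
  next
    case False
    then show ?thesis
      using Suc by (simp add: simple_process_def)
  qed
qed (simp add: simple_process_def)

text \<open>Writing the length as a difference of endpoints clipped by
  \<open>max s (min t _)\<close> makes the time integral of a squared simple process a discrete
  variation along the clipped partition, the form that \<open>sum_tail_bound\<close>
  expects.\<close>

lemma measure_Icc_Int_Ioc:
  fixes s t x y :: real
  assumes "s \<le> t" "x \<le> y"
  shows "measure lborel ({s..t} \<inter> {x<..y}) = max s (min t y) - max s (min t x)"
proof -
  consider "y < s" | "x < s" "s \<le> y" | "s \<le> x" "x \<le> t" | "t < x"
    by linarith
  then show ?thesis
  proof cases
    case 1
    then have "{s..t} \<inter> {x<..y} = {}" by auto
    with 1 assms show ?thesis by simp
  next
    case 2
    then have "{s..t} \<inter> {x<..y} = {s..min t y}" by auto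
    with 2 assms show ?thesis by simp
  next
    case 3
    then have "{s..t} \<inter> {x<..y} = {x<..min t y}" by auto
    with 3 assms show ?thesis by simp
  next
    case 4
    then have "{s..t} \<inter> {x<..y} = {}" by auto
    with 4 assms show ?thesis by simp
  qed
qed

lemma simple_process_measurable [measurable]:
  "(\<lambda>u. simple_process m \<tau> \<xi> u \<omega>) \<in> borel_measurable borel"
  unfolding simple_process_def by measurable

lemma set_integral_simple_process_square:
  assumes "\<And>i. i < m \<Longrightarrow> \<tau> i \<le> \<tau> (Suc i)" and st: "s \<le> t"
  shows "set_integrable lborel {s..t} (\<lambda>u. (simple_process m \<tau> \<xi> u \<omega>)\<^sup>2)"
    and "(LINT u:{s..t}|lborel. (simple_process m \<tau> \<xi> u \<omega>)\<^sup>2) =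
      (\<Sum>i<m. (\<xi> i \<omega>)\<^sup>2 * (max s (min t (\<tau> (Suc i))) - max s (min t (\<tau> i))))"
proof -
  have eq: "indicator {s..t} u *\<^sub>R (simple_process m \<tau> \<xi> u \<omega>)\<^sup>2 =
      (\<Sum>i<m. (\<xi> i \<omega>)\<^sup>2 * indicator ({s..t} \<inter> {\<tau> i<..\<tau> (Suc i)}) u)" for u
    by (simp only: simple_process_square[where m=m and \<tau>=\<tau>, OF assms(1)] real_scaleR_def sum_distrib_left)
       (intro sum.cong refl, simp add: indicator_def)
  have fin: "emeasure lborel ({s..t} \<inter> A) < \<infinity>" if "A \<in> sets lborel" for A
    by (rule le_less_trans[OF emeasure_mono[of _ "{s..t}"]]) (use st in auto)
  have int: "integrable lborel (\<lambda>u. (\<xi> i \<omega>)\<^sup>2 * indicator ({s..t} \<inter> {\<tau> i<..\<tau> (Suc i)}) u)" for i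
    using fin[of "{\<tau> i<..\<tau> (Suc i)}"] by (intro integrable_mult_right integrable_real_indicator) auto
  show "set_integrable lborel {s..t} (\<lambda>u. (simple_process m \<tau> \<xi> u \<omega>)\<^sup>2)"
    unfolding set_integrable_def eq using int by (intro Bochner_Integration.integrable_sum) auto
  have "(\<integral>u. (\<xi> i \<omega>)\<^sup>2 * indicator ({s..t} \<inter> {\<tau> i<..\<tau> (Suc i)}) u \<partial>lborel) =
      (\<xi> i \<omega>)\<^sup>2 * (max s (min t (\<tau> (Suc i))) - max s (min t (\<tau> i)))" if "i < m" for i
    using fin[of "{\<tau> i<..\<tau> (Suc i)}"] measure_Icc_Int_Ioc[OF st assms(1)[OF that]] by simp
  then show "(LINT u:{s..t}|lborel. (simple_process m \<tau> \<xi> u \<omega>)\<^sup>2) =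
      (\<Sum>i<m. (\<xi> i \<omega>)\<^sup>2 * (max s (min t (\<tau> (Suc i))) - max s (min t (\<tau> i))))"
    unfolding set_lebesgue_integral_def eq
    by (subst Bochner_Integration.integral_sum[OF int]) (intro sum.cong; simp)
qed

context real_wiener
begin

text \<open>Over \<open>{s..t}\<close> the simple integral is a sum along the clipped partition
  \<open>c\<close>, to which \<open>sum_tail_bound\<close> applies. The difficulty is adaptedness:
  for \<open>\<tau> i\<close> beyond \<open>t\<close> the clipped point \<open>c i\<close> precedes
  \<open>\<tau> i\<close>, and \<open>\<xi> i\<close> need not be known at time \<open>c i\<close>.
  Exactly then the clipped interval has length 0, so \<open>\<zeta>\<close> may replace
  \<open>\<xi> i\<close> by 0 without changing the sums.\<close>

lemma simple_integral_tail_bound: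
  assumes simple: "simple_integrand M F m \<tau> \<xi>" and st: "0 \<le> s" "s \<le> t" and "0 < \<delta>" "0 \<le> N"
  defines "A \<equiv> {\<omega>\<in>space M. (LINT u:{s..t}|lborel. (simple_process m \<tau> \<xi> u \<omega>)\<^sup>2) \<le> N \<and>
      \<delta> < \<bar>simple_integral m \<tau> \<xi> W t \<omega> - simple_integral m \<tau> \<xi> W s \<omega>\<bar>}"
  shows "A \<in> sets M" and "prob A \<le> N / \<delta>\<^sup>2"
proof -
  define c where "c i = max s (min t (\<tau> i))" for i
  define \<zeta> where "\<zeta> i = (if c i < c (Suc i) then \<xi> i else (\<lambda>_. 0))" for i
  have \<tau>: "0 \<le> \<tau> 0" "\<And>i. i < m \<Longrightarrow> \<tau> i \<le> \<tau> (Suc i)"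
    and \<xi>: "\<And>i. i < m \<Longrightarrow> \<xi> i \<in> borel_measurable (F (\<tau> i))"
      "\<And>i. i < m \<Longrightarrow> \<exists>B. \<forall>\<omega>\<in>space M. \<bar>\<xi> i \<omega>\<bar> \<le> B"
    using simple by (auto simp: simple_integrand_def)
  have c: "0 \<le> c i" "i < m \<Longrightarrow> c i \<le> c (Suc i)" for i
    using \<tau>(2)[of i] st by (auto simp: c_def)
  have "\<tau> i \<le> c i" if "c i < c (Suc i)" for i
    using that st unfolding c_def max_def min_def by (smt (verit))
  then have \<zeta>: "i < m \<Longrightarrow> \<zeta> i \<in> borel_measurable (F (c i))" for i
    using measurable_F_mono[OF \<xi>(1)] by (cases "c i < c (Suc i)") (simp_all add: \<zeta>_def)
  have bdd: "i < m \<Longrightarrow> \<exists>B. \<forall>\<omega>\<in>space M. \<bar>\<zeta> i \<omega>\<bar> \<le> B" for i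
    using \<xi>(2)[of i] by (cases "c i < c (Suc i)") (auto simp: \<zeta>_def)
  \<comment> \<open>Both sides vanish for \<open>x\<close> up to \<open>s\<close>; beyond
    \<open>s\<close> the left minimum with \<open>s\<close> is \<open>s\<close> itself. The common
    term \<open>W s\<close> cancels between consecutive partition points.\<close>
  have W: "W (min t x) \<omega> - W (min s x) \<omega> = W (max s (min t x)) \<omega> - W s \<omega>" for x \<omega>
    using st unfolding max_def min_def by (smt (verit))
  have "simple_integral m \<tau> \<xi> W t \<omega> - simple_integral m \<tau> \<xi> W s \<omega> =
      (\<Sum>i<m. \<zeta> i \<omega> * (W (c (Suc i)) \<omega> - W (c i) \<omega>))" for \<omega>
    unfolding simple_integral_def sum_subtractf[symmetric]
  proof (rule sum.cong)
    fix i assume "i \<in> {..<m}"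
    then have "c i \<le> c (Suc i)"
      using c(2) by simp
    moreover have "\<xi> i \<omega> * (W (min t (\<tau> (Suc i))) \<omega> - W (min t (\<tau> i)) \<omega>) -
        \<xi> i \<omega> * (W (min s (\<tau> (Suc i))) \<omega> - W (min s (\<tau> i)) \<omega>) =
        \<xi> i \<omega> * ((W (min t (\<tau> (Suc i))) \<omega> - W (min s (\<tau> (Suc i))) \<omega>) -
          (W (min t (\<tau> i)) \<omega> - W (min s (\<tau> i)) \<omega>))"
      by (simp add: algebra_simps)
    ultimately show "\<xi> i \<omega> * (W (min t (\<tau> (Suc i))) \<omega> - W (min t (\<tau> i)) \<omega>) -
        \<xi> i \<omega> * (W (min s (\<tau> (Suc i))) \<omega> - W (min s (\<tau> i)) \<omega>) =
        \<zeta> i \<omega> * (W (c (Suc i)) \<omega> - W (c i) \<omega>)"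
      unfolding W c_def[symmetric] by (auto simp: \<zeta>_def)
  qed simp
  moreover have "(LINT u:{s..t}|lborel. (simple_process m \<tau> \<xi> u \<omega>)\<^sup>2) =
      (\<Sum>i<m. (\<zeta> i \<omega>)\<^sup>2 * (c (Suc i) - c i))" for \<omega>
    unfolding c_def
  proof (subst set_integral_simple_process_square(2)[OF _ st(2)], goal_cases)
    case (1 i)
    then show ?case by (rule \<tau>(2))
  next
    case 2
    show ?case
      unfolding c_def[symmetric]
  proof (rule sum.cong)
    fix i assume "i \<in> {..<m}"
    then have "c i \<le> c (Suc i)"
      using c(2) by simp
    then show "(\<xi> i \<omega>)\<^sup>2 * (c (Suc i) - c i) = (\<zeta> i \<omega>)\<^sup>2 * (c (Suc i) - c i)"
      by (auto simp: \<zeta>_def)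
    qed simp
  qed
  ultimately have A: "A = {\<omega>\<in>space M. (\<Sum>i<m. (\<zeta> i \<omega>)\<^sup>2 * (c (Suc i) - c i)) \<le> N \<and>
      \<delta> < \<bar>\<Sum>i<m. \<zeta> i \<omega> * (W (c (Suc i)) \<omega> - W (c i) \<omega>)\<bar>}"
    unfolding A_def by simp
  have [measurable]: "i < m \<Longrightarrow> \<zeta> i \<in> borel_measurable M" "W (c i) \<in> borel_measurable M" for i
    using measurable_F[OF \<zeta>] c by auto
  show "A \<in> sets M"
    unfolding A by measurable
  show "prob A \<le> N / \<delta>\<^sup>2"
    unfolding A using c \<zeta> bdd \<open>0 < \<delta>\<close> \<open>0 \<le> N\<close> by (intro sum_tail_bound)
qed

text \<open>The bound for simple integrals is carried through the limit in probability. The error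
  \<delta> is split into three parts: the approximation errors at \<open>t\<close> and at
  \<open>s\<close>, and the increment of the simple integral. When the L2 distance of the integrands
  and \<open>V\<close> are both at most \<open>N\<close>, the squared approximant integrates to at
  most \<open>4 * N\<close>; with the threshold \<open>\<delta> / 3\<close> this gives the factor 36
  = 4 * 9. \<open>V\<close> is any measurable majorant of the variation of \<open>H\<close> over
  \<open>{s..t}\<close>.\<close>

lemma ito_integral_tail_bound:
  assumes ito: "is_ito_integral M F W H J" and st: "0 \<le> s" "s \<le> t" and "0 < \<delta>" "0 < N"
    and V [measurable]: "V \<in> borel_measurable M"
    and le: "AE \<omega> in M. (LINT u:{s..t}|lborel. (H u \<omega>)\<^sup>2) \<le> V \<omega>"
  shows "\<P>(\<omega> in M. \<delta> < \<bar>J t \<omega> - J s \<omega>\<bar>) \<le> \<P>(\<omega> in M. N < V \<omega>) + 36 * N / \<delta>\<^sup>2"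
proof -
  have t: "0 \<le> t" using st by simp
  have prog: "progressive F H"
    and sq: "AE \<omega> in M. \<forall>t\<ge>0. set_integrable lborel {0..t} (\<lambda>s. (H s \<omega>)\<^sup>2)"
    using ito by (auto simp: is_ito_integral_def)
  obtain m \<tau> \<xi> where simple: "\<And>k::nat. simple_integrand M F (m k) (\<tau> k) (\<xi> k)"
    and lim: "\<And>t. 0 \<le> t \<Longrightarrow> conv_in_prob M
             (\<lambda>k \<omega>. LINT s:{0..t}|lborel. (simple_process (m k) (\<tau> k) (\<xi> k) s \<omega> - H s \<omega>)\<^sup>2)
             (\<lambda>\<omega>. 0) sequentially"
      "\<And>t. 0 \<le> t \<Longrightarrow> conv_in_prob M (\<lambda>k. simple_integral (m k) (\<tau> k) (\<xi> k) W t) (J t) sequentially"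
    using ito unfolding is_ito_integral_def by blast
  let ?P = "\<lambda>k. simple_process (m k) (\<tau> k) (\<xi> k)"
  let ?I = "\<lambda>k. simple_integral (m k) (\<tau> k) (\<xi> k) W"
  let ?L = "\<lambda>k \<omega>. LINT s:{0..t}|lborel. (?P k s \<omega> - H s \<omega>)\<^sup>2"
  define p1 where "p1 k = \<P>(\<omega> in M. dist (?I k t \<omega>) (J t \<omega>) > \<delta> / 3)" for k
  define p2 where "p2 k = \<P>(\<omega> in M. dist (?I k s \<omega>) (J s \<omega>) > \<delta> / 3)" for k
  define p3 where "p3 k = \<P>(\<omega> in M. dist (?L k \<omega>) 0 > N)" for k
  have [measurable]: "?I k t \<in> borel_measurable M" "?I k s \<in> borel_measurable M"
    "J t \<in> borel_measurable M" "J s \<in> borel_measurable M" "?L k \<in> borel_measurable M" for k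
    using lim[OF t] lim[OF st(1)] by (auto simp: conv_in_prob_def)
  have conv: "(\<lambda>k. \<P>(\<omega> in M. dist (U k \<omega>) (Z \<omega>) > r)) \<longlonglongrightarrow> 0"
    if "conv_in_prob M U Z sequentially" "0 < r" for U :: "nat \<Rightarrow> 'a \<Rightarrow> real" and Z r
    using that by (auto simp: conv_in_prob_def)
  have "p1 \<longlonglongrightarrow> 0" "p2 \<longlonglongrightarrow> 0" "p3 \<longlonglongrightarrow> 0"
    using conv[OF lim(2)[OF t], of "\<delta> / 3"] conv[OF lim(2)[OF st(1)], of "\<delta> / 3"]
      conv[OF lim(1)[OF t] \<open>0 < N\<close>] \<open>0 < \<delta>\<close>
    unfolding p1_def p2_def p3_def by simp_all
  \<comment> \<open>The probability to be bounded does not involve \<open>k\<close>, so it is enough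
    to bound it for each \<open>k\<close> by a quantity whose vanishing terms are the approximation
    errors.\<close>
  then have "(\<lambda>k. p1 k + p2 k + p3 k + \<P>(\<omega> in M. N < V \<omega>) + 36 * N / \<delta>\<^sup>2)
      \<longlonglongrightarrow> 0 + 0 + 0 + \<P>(\<omega> in M. N < V \<omega>) + 36 * N / \<delta>\<^sup>2"
    by (intro tendsto_intros)
  moreover have "\<P>(\<omega> in M. \<delta> < \<bar>J t \<omega> - J s \<omega>\<bar>) \<le>
      p1 k + p2 k + p3 k + \<P>(\<omega> in M. N < V \<omega>) + 36 * N / \<delta>\<^sup>2" for k
  proof -
    define A1 where "A1 = {\<omega>\<in>space M. dist (?I k t \<omega>) (J t \<omega>) > \<delta> / 3}"
    define A2 where "A2 = {\<omega>\<in>space M. dist (?I k s \<omega>) (J s \<omega>) > \<delta> / 3}"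
    define A3 where "A3 = {\<omega>\<in>space M. dist (?L k \<omega>) 0 > N}"
    define A4 where "A4 = {\<omega>\<in>space M. N < V \<omega>}"
    define A5 where "A5 = {\<omega>\<in>space M. (LINT u:{s..t}|lborel. (?P k u \<omega>)\<^sup>2) \<le> 4 * N \<and>
      \<delta> / 3 < \<bar>?I k t \<omega> - ?I k s \<omega>\<bar>}"
    have A5: "A5 \<in> sets M" "prob A5 \<le> 4 * N / (\<delta> / 3)\<^sup>2"
      unfolding A5_def using \<open>0 < \<delta>\<close> \<open>0 < N\<close>
      by (intro simple_integral_tail_bound[OF simple st]; simp)+
    have meas: "A1 \<in> sets M" "A2 \<in> sets M" "A3 \<in> sets M" "A4 \<in> sets M"
      unfolding A1_def A2_def A3_def A4_def by measurable
    have "AE \<omega> in M. \<omega> \<in> {\<omega>\<in>space M. \<delta> < \<bar>J t \<omega> - J s \<omega>\<bar>} \<longrightarrow> \<omega> \<in> A1 \<union> A2 \<union> A3 \<union> A4 \<union> A5"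
      using le sq AE_space
    proof eventually_elim
      case (elim \<omega>)
      have H: "set_integrable lborel {0..t} (\<lambda>s. (H s \<omega>)\<^sup>2)"
        using elim t by simp
      \<comment> \<open>Integrability of the squared path yields measurability of the square only.
        Measurability of the path itself, needed for the square of
        \<open>?P k u \<omega> - H u \<omega>\<close>, comes from progressive measurability by
        taking sections.\<close>
      have "\<omega> \<in> space (F t)"
        using elim filtration by (simp add: filtration_def)
      with prog t have "(\<lambda>u. H u \<omega>) \<in> borel_measurable (restrict_space borel {0..t})"
        unfolding progressive_def using measurable_Pair1 by fastforce
      then have Hm: "set_borel_measurable borel {0..t} (\<lambda>u. H u \<omega>)"
        by (simp add: set_borel_measurable_def borel_measurable_restrict_space_iff mult.commute)
      have \<tau>: "\<And>i. i < m k \<Longrightarrow> \<tau> k i \<le> \<tau> k (Suc i)"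
        using simple[of k] by (auto simp: simple_integrand_def)
      have P: "set_integrable lborel {x..y} (\<lambda>u. (?P k u \<omega>)\<^sup>2)" if "x \<le> y" for x y
        using \<tau> that by (rule set_integral_simple_process_square(1))
      have D: "set_integrable lborel {0..t} (\<lambda>u. (?P k u \<omega> - H u \<omega>)\<^sup>2)"
        unfolding set_integrable_def
      proof (rule Bochner_Integration.integrable_bound)
        show "integrable lborel (\<lambda>u. 2 * (indicator {0..t} u *\<^sub>R (?P k u \<omega>)\<^sup>2) +
            2 * (indicator {0..t} u *\<^sub>R (H u \<omega>)\<^sup>2))"
          using P[OF t] H by (auto simp: set_integrable_def)
        have "indicator {0..t} u *\<^sub>R (?P k u \<omega> - H u \<omega>)\<^sup>2 =
            (indicator {0..t} u * ?P k u \<omega> - indicator {0..t} u *\<^sub>R H u \<omega>)\<^sup>2" for u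
          by (simp add: indicator_def)
        then show "(\<lambda>u. indicator {0..t} u *\<^sub>R (?P k u \<omega> - H u \<omega>)\<^sup>2) \<in> borel_measurable lborel"
          using Hm by (simp add: set_borel_measurable_def)
        have "(x - y)\<^sup>2 \<le> 2 * x\<^sup>2 + 2 * y\<^sup>2" for x y :: real
          using zero_le_power2[of "x + y"] by (simp add: power2_eq_square algebra_simps)
        then show "AE u in lborel. norm (indicator {0..t} u *\<^sub>R (?P k u \<omega> - H u \<omega>)\<^sup>2) \<le>
            norm (2 * (indicator {0..t} u *\<^sub>R (?P k u \<omega>)\<^sup>2) + 2 * (indicator {0..t} u *\<^sub>R (H u \<omega>)\<^sup>2))"
          by (intro AE_I2) (simp add: indicator_def)
      qed
      have sub: "{s..t} \<subseteq> {0..t}" "{s..t} \<in> sets lborel"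
        using st by auto
      have Hs: "set_integrable lborel {s..t} (\<lambda>s. (H s \<omega>)\<^sup>2)"
        by (rule set_integrable_subset[OF H sub(2,1)])
      have Ds: "set_integrable lborel {s..t} (\<lambda>u. (?P k u \<omega> - H u \<omega>)\<^sup>2)"
        by (rule set_integrable_subset[OF D sub(2,1)])
      have "x\<^sup>2 \<le> 2 * (x - y)\<^sup>2 + 2 * y\<^sup>2" for x y :: real
        using zero_le_power2[of "x - 2 * y"] by (simp add: power2_eq_square algebra_simps)
      then have "(LINT u:{s..t}|lborel. (?P k u \<omega>)\<^sup>2) \<le>
          (LINT u:{s..t}|lborel. 2 * (?P k u \<omega> - H u \<omega>)\<^sup>2 + 2 * (H u \<omega>)\<^sup>2)"
        using P[OF st(2)] Hs Ds by (intro set_integral_mono) auto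
      also have "\<dots> = 2 * (LINT u:{s..t}|lborel. (?P k u \<omega> - H u \<omega>)\<^sup>2) +
          2 * (LINT u:{s..t}|lborel. (H u \<omega>)\<^sup>2)"
        using Hs Ds by (simp add: set_integral_add)
      also have "(LINT u:{s..t}|lborel. (?P k u \<omega> - H u \<omega>)\<^sup>2) \<le> ?L k \<omega>"
        unfolding set_lebesgue_integral_def
        using Ds D sub by (intro integral_mono) (auto simp: set_integrable_def indicator_def)
      finally have le2: "(LINT u:{s..t}|lborel. (?P k u \<omega>)\<^sup>2) \<le> 2 * ?L k \<omega> + 2 * V \<omega>"
        using elim(1) by simp
      show ?case
      proof (intro impI, rule ccontr)
        assume *: "\<omega> \<in> {\<omega>\<in>space M. \<delta> < \<bar>J t \<omega> - J s \<omega>\<bar>}" "\<omega> \<notin> A1 \<union> A2 \<union> A3 \<union> A4 \<union> A5"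
        then have "\<bar>?I k t \<omega> - J t \<omega>\<bar> \<le> \<delta> / 3" "\<bar>?I k s \<omega> - J s \<omega>\<bar> \<le> \<delta> / 3"
          "\<bar>?L k \<omega>\<bar> \<le> N" "V \<omega> \<le> N"
          by (auto simp: A1_def A2_def A3_def A4_def dist_real_def)
        moreover from this le2 have "(LINT u:{s..t}|lborel. (?P k u \<omega>)\<^sup>2) \<le> 4 * N"
          by linarith
        ultimately show False
          using * by (auto simp: A5_def abs_if split: if_splits)
      qed
    qed
    then have "\<P>(\<omega> in M. \<delta> < \<bar>J t \<omega> - J s \<omega>\<bar>) \<le> prob (A1 \<union> A2 \<union> A3 \<union> A4 \<union> A5)"
      using meas A5 by (intro finite_measure_mono_AE) auto
    also have "\<dots> \<le> prob A1 + prob A2 + prob A3 + prob A4 + prob A5"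
      using meas A5(1)
      by (intro order_trans[OF measure_Un_le] add_mono order_refl) auto
    also have "\<dots> \<le> p1 k + p2 k + p3 k + \<P>(\<omega> in M. N < V \<omega>) + 36 * N / \<delta>\<^sup>2"
      using A5(2) unfolding p1_def p2_def p3_def A1_def A2_def A3_def A4_def
      by (simp add: power_divide field_simps)
    finally show ?thesis .
  qed
  ultimately show ?thesis
    by (intro LIMSEQ_le_const) auto
qed

end

section \<open>Joint measurability and time integrals of moments\<close>

lemma tendsto_floor_mult_divide:
  fixes u :: real
  shows "(\<lambda>n. of_int \<lfloor>real (Suc n) * u\<rfloor> / real (Suc n)) \<longlonglongrightarrow> u"
proof (rule real_tendsto_sandwich)
  show "\<forall>\<^sub>F n in sequentially. u - inverse (real (Suc n)) \<le> of_int \<lfloor>real (Suc n) * u\<rfloor> / real (Suc n)"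
  proof (intro always_eventually allI)
    fix n
    have "real (Suc n) * u - 1 \<le> of_int \<lfloor>real (Suc n) * u\<rfloor>"
      by linarith
    then have "(real (Suc n) * u - 1) / real (Suc n) \<le> of_int \<lfloor>real (Suc n) * u\<rfloor> / real (Suc n)"
      by (intro divide_right_mono) auto
    then show "u - inverse (real (Suc n)) \<le> of_int \<lfloor>real (Suc n) * u\<rfloor> / real (Suc n)"
      by (simp add: diff_divide_distrib inverse_eq_divide del: of_nat_Suc)
  qed
  show "\<forall>\<^sub>F n in sequentially. of_int \<lfloor>real (Suc n) * u\<rfloor> / real (Suc n) \<le> u"
  proof (intro always_eventually allI)
    fix n
    have "of_int \<lfloor>real (Suc n) * u\<rfloor> / real (Suc n) \<le> (real (Suc n) * u) / real (Suc n)"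
      by (intro divide_right_mono) auto
    then show "of_int \<lfloor>real (Suc n) * u\<rfloor> / real (Suc n) \<le> u"
      by (simp del: of_nat_Suc)
  qed
  show "(\<lambda>n. u - inverse (real (Suc n))) \<longlonglongrightarrow> u"
    using tendsto_diff[OF tendsto_const LIMSEQ_inverse_real_of_nat, of u] by simp
qed simp

text \<open>Truncating time at \<open>0\<close> because nothing is known about \<open>X\<close> at negative times.\<close>

lemma continuous_process_measurable:
  fixes X :: "real \<Rightarrow> 'a \<Rightarrow> 'b :: euclidean_space"
  assumes meas: "\<And>t. 0 \<le> t \<Longrightarrow> X t \<in> borel_measurable M"
    and cont: "\<And>\<omega>. \<omega> \<in> space M \<Longrightarrow> continuous_on {0..} (\<lambda>t. X t \<omega>)"
  shows "(\<lambda>(u, \<omega>). X (max 0 u) \<omega>) \<in> borel_measurable (borel \<Otimes>\<^sub>M M)"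
proof (rule borel_measurable_LIMSEQ_metric
    [where f="\<lambda>n (u, \<omega>). X (max 0 (of_int \<lfloor>real (Suc n) * u\<rfloor> / real (Suc n))) \<omega>"])
  fix n
  let ?t = "\<lambda>n i. max 0 (of_int i / real (Suc n))"
  \<comment> \<open>With time rounded down to the grid of mesh \<open>1 / real (Suc n)\<close> only
    countably many random variables occur, which makes the rounded process jointly measurable; path
    continuity lets the mesh tend to 0.\<close>
  have "(\<lambda>p. (\<lambda>i p. X (?t n i) (snd p)) \<lfloor>real (Suc n) * fst p\<rfloor> p) \<in> borel_measurable (borel \<Otimes>\<^sub>M M)"
  proof (rule measurable_compose_countable[where f="\<lambda>i p. X (?t n i) (snd p)"])
    show "(\<lambda>p. X (?t n i) (snd p)) \<in> borel_measurable (borel \<Otimes>\<^sub>M M)" for i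
      by (rule measurable_compose[OF measurable_snd meas]) simp
    show "(\<lambda>p. \<lfloor>real (Suc n) * fst p\<rfloor>) \<in> measurable (borel \<Otimes>\<^sub>M M) (count_space UNIV)"
      by measurable
  qed
  then show "(\<lambda>(u, \<omega>). X (max 0 (real_of_int \<lfloor>real (Suc n) * u\<rfloor> / real (Suc n))) \<omega>)
      \<in> borel_measurable (borel \<Otimes>\<^sub>M M)"
    by (simp add: split_beta')
next
  fix p :: "real \<times> 'a" assume "p \<in> space (borel \<Otimes>\<^sub>M M)"
  then obtain u \<omega> where p: "p = (u, \<omega>)" "\<omega> \<in> space M"
    by (auto simp: space_pair_measure)
  have "(\<lambda>n. max 0 (of_int \<lfloor>real (Suc n) * u\<rfloor> / real (Suc n))) \<longlonglongrightarrow> max 0 u"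
    by (intro tendsto_max tendsto_const tendsto_floor_mult_divide)
  from continuous_on_tendsto_compose[OF cont[OF p(2)] this]
  have "(\<lambda>n. X (max 0 (of_int \<lfloor>real (Suc n) * u\<rfloor> / real (Suc n))) \<omega>) \<longlonglongrightarrow> X (max 0 u) \<omega>"
    by simp
  then show "(\<lambda>n. (\<lambda>(u, \<omega>). X (max 0 (of_int \<lfloor>real (Suc n) * u\<rfloor> / real (Suc n))) \<omega>) p)
      \<longlonglongrightarrow> (\<lambda>(u, \<omega>). X (max 0 u) \<omega>) p"
    by (simp add: p)
qed

lemma integrable_nn_integral_le:
  assumes [measurable]: "f \<in> borel_measurable M" and "\<And>x. x \<in> space M \<Longrightarrow> 0 \<le> f x"
    and le: "(\<integral>\<^sup>+x. ennreal (f x) \<partial>M) \<le> ennreal C" and "0 \<le> C"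
  shows "integrable M f" "(\<integral>x. f x \<partial>M) \<le> C"
proof -
  have nn: "AE x in M. 0 \<le> f x"
    using assms by (intro AE_I2) auto
  show i: "integrable M f"
    using nn le le_less_trans[OF le] by (intro integrableI_nonneg) auto
  then have "ennreal (\<integral>x. f x \<partial>M) \<le> ennreal C"
    using nn_integral_eq_integral[OF i nn] le by simp
  then show "(\<integral>x. f x \<partial>M) \<le> C"
    using \<open>0 \<le> C\<close> by simp
qed

text \<open>By Fubini the mean of \<open>V\<close> is at most \<open>K * (t - s)\<close>, and
  Markov's inequality gives the tail. \<open>V\<close> dominates both the drift and the variation of
  the stochastic integrals, up to powers of the growth constant.\<close>

lemma time_integral_moment_bound:
  fixes X :: "real \<Rightarrow> 'a \<Rightarrow> 'b :: euclidean_space"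
  assumes "prob_space M"
    and meas: "\<And>t. 0 \<le> t \<Longrightarrow> X t \<in> borel_measurable M"
    and cont: "\<And>\<omega>. \<omega> \<in> space M \<Longrightarrow> continuous_on {0..} (\<lambda>t. X t \<omega>)"
    and K: "\<And>t. 0 \<le> t \<Longrightarrow> (\<integral>\<^sup>+\<omega>. ennreal ((1 + norm (X t \<omega>))\<^sup>2) \<partial>M) \<le> ennreal K" "0 \<le> K"
    and st: "0 \<le> s" "s \<le> t"
  defines "V \<equiv> \<lambda>\<omega>. LINT u:{s..t}|lborel. (1 + norm (X u \<omega>))\<^sup>2"
  shows "V \<in> borel_measurable M"
    and "0 < N \<Longrightarrow> measure M {\<omega>\<in>space M. N < V \<omega>} \<le> K * (t - s) / N"
proof -
  interpret prob_space M by fact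
  interpret pair_sigma_finite lborel M
    by (intro pair_sigma_finite.intro sigma_finite_lborel) unfold_locales
  let ?g = "\<lambda>u \<omega>. indicator {s..t} u * (1 + norm (X (max 0 u) \<omega>))\<^sup>2"
  have "(\<lambda>p. X (max 0 (fst p)) (snd p)) \<in> borel_measurable (lborel \<Otimes>\<^sub>M M)"
    using continuous_process_measurable[OF meas cont] by (simp add: split_beta')
  then have [measurable]: "(\<lambda>(u, \<omega>). ?g u \<omega>) \<in> borel_measurable (lborel \<Otimes>\<^sub>M M)"
    unfolding split_beta' by measurable
  then have [measurable]: "(\<lambda>(\<omega>, u). ?g u \<omega>) \<in> borel_measurable (M \<Otimes>\<^sub>M lborel)"
    by (subst measurable_pair_swap_iff) simp
  \<comment> \<open>The clipping of time at 0 is invisible here because 0 \<le> s.\<close>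
  have eq: "indicator {s..t} u *\<^sub>R (1 + norm (X u \<omega>))\<^sup>2 = ?g u \<omega>" for u \<omega>
    using st by (auto simp: indicator_def max_def)
  have V: "V = (\<lambda>\<omega>. \<integral>u. ?g u \<omega> \<partial>lborel)"
    unfolding V_def set_lebesgue_integral_def eq ..
  show [measurable]: "V \<in> borel_measurable M"
    unfolding V by measurable
  have Vnn: "0 \<le> V \<omega>" for \<omega>
    unfolding V by (intro Bochner_Integration.integral_nonneg) auto
  \<comment> \<open>Continuity of the path guarantees integrability; a Bochner integral without it
    would be 0 by convention and would not match the nonnegative integral.\<close>
  have "ennreal (V \<omega>) = (\<integral>\<^sup>+u. ennreal (?g u \<omega>) \<partial>lborel)" if "\<omega> \<in> space M" for \<omega>
  proof -
    have "set_integrable lborel {s..t} (\<lambda>u. (1 + norm (X u \<omega>))\<^sup>2)"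
      using st by (intro borel_integrable_atLeastAtMost' continuous_intros
          continuous_on_subset[OF cont[OF that]]) auto
    then show ?thesis
      unfolding V set_integrable_def eq by (intro nn_integral_eq_integral[symmetric]) auto
  qed
  then have "(\<integral>\<^sup>+\<omega>. ennreal (V \<omega>) \<partial>M) = (\<integral>\<^sup>+\<omega>. \<integral>\<^sup>+u. ennreal (?g u \<omega>) \<partial>lborel \<partial>M)"
    by (rule nn_integral_cong)
  also have "\<dots> = (\<integral>\<^sup>+u. \<integral>\<^sup>+\<omega>. ennreal (?g u \<omega>) \<partial>M \<partial>lborel)"
    by (rule Fubini') measurable
  also have "\<dots> \<le> (\<integral>\<^sup>+u. ennreal K * indicator {s..t} u \<partial>lborel)"
  proof (rule nn_integral_mono)
    fix u
    show "(\<integral>\<^sup>+\<omega>. ennreal (?g u \<omega>) \<partial>M) \<le> ennreal K * indicator {s..t} u"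
      using K(1)[of u] st by (auto simp: indicator_def max_def)
  qed
  also have "\<dots> = ennreal (K * (t - s))"
    using st K(2) by (simp add: nn_integral_cmult_indicator ennreal_mult)
  finally have *: "(\<integral>\<^sup>+\<omega>. ennreal (V \<omega>) \<partial>M) \<le> ennreal (K * (t - s))" .
  have EV: "integrable M V" "(\<integral>\<omega>. V \<omega> \<partial>M) \<le> K * (t - s)"
    using integrable_nn_integral_le[OF _ _ *] Vnn K(2) st by auto
  show "measure M {\<omega>\<in>space M. N < V \<omega>} \<le> K * (t - s) / N" if "0 < N"
  proof -
    have "measure M {\<omega>\<in>space M. N < V \<omega>} \<le> measure M {\<omega>\<in>space M. N \<le> V \<omega>}"
      by (rule finite_measure_mono) auto
    also have "\<dots> \<le> (\<integral>\<omega>. V \<omega> \<partial>M) / N"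
      using EV(1) Vnn that by (intro integral_Markov_inequality_measure[where A="{}"]) auto
    also have "\<dots> \<le> K * (t - s) / N"
      using EV(2) that by (intro divide_right_mono) auto
    finally show ?thesis .
  qed
qed

section \<open>Increments of the solution over short time intervals\<close>

text \<open>An increment is a drift integral plus \<open>CARD('d) * CARD('r)\<close> scalar Ito
  increments, all controlled by the same \<open>V\<close>. The mean of \<open>V\<close> is at most
  \<open>K\<close> times the length of the interval, whatever its position, so \<open>r\<close> does
  not depend on \<open>s\<close>.\<close>

lemma sde_increment_tail:
  fixes X :: "real \<Rightarrow> 'a \<Rightarrow> real ^ 'd" and w :: "real \<Rightarrow> 'a \<Rightarrow> real ^ 'r"
  assumes "prob_space M" and sde: "sde_solution M w b a x0 X"
    and C: "0 < C" "\<And>x. norm (b x) \<le> C * (1 + norm x)" "\<And>x. norm (a x) \<le> C * (1 + norm x)"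
    and K: "0 < K" "\<And>t. 0 \<le> t \<Longrightarrow> (\<integral>\<^sup>+\<omega>. ennreal ((1 + norm (X t \<omega>))\<^sup>2) \<partial>M) \<le> ennreal K"
    and \<delta>: "0 < \<delta>" and \<eta>: "0 < \<eta>"
  shows "\<exists>r>0. \<forall>s t. 0 \<le> s \<and> s \<le> t \<and> t \<le> s + r \<longrightarrow>
    measure M {\<omega>\<in>space M. \<delta> < norm (X t \<omega> - X s \<omega>)} \<le> \<eta>"
proof -
  interpret prob_space M by fact
  obtain F J where w: "wiener_wrt M F w"
    and XF: "\<And>t. 0 \<le> t \<Longrightarrow> X t \<in> borel_measurable (F t)"
    and cont: "\<And>\<omega>. \<omega> \<in> space M \<Longrightarrow> continuous_on {0..} (\<lambda>t. X t \<omega>)"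
    and ito: "\<And>i j. is_ito_integral M F (\<lambda>s \<omega>. w s \<omega> $ j) (\<lambda>s \<omega>. a (X s \<omega>) $ i $ j) (J i j)"
    and sol: "\<And>t. 0 \<le> t \<Longrightarrow> AE \<omega> in M. set_integrable lborel {0..t} (\<lambda>s. b (X s \<omega>)) \<and>
      X t \<omega> = x0 \<omega> + (LINT s:{0..t}|lborel. b (X s \<omega>)) + (\<chi> i. \<Sum>j\<in>UNIV. J i j t \<omega>)"
    using sde unfolding sde_solution_def by blast
  have X [measurable]: "X t \<in> borel_measurable M" if "0 \<le> t" for t
    using XF[OF that] w by (auto simp: wiener_wrt_def intro: measurable_from_subalg)
  \<comment> \<open>Half of \<delta> goes to the drift and half is shared by the \<open>B\<close>
    scalar integrals, which gives \<open>\<delta>'\<close>. The probability \<eta> is split into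
    thirds: \<open>N\<close> makes the \<open>B\<close> terms
    \<open>36 * N / \<delta>'\<^sup>2\<close> add up to \<open>\<eta> / 3\<close>; the two entries
    of \<open>r\<close> make the drift failure, and the \<open>B\<close> events of excessive
    variation together, cost at most \<open>\<eta> / 3\<close> each.\<close>
  define B where "B = real CARD('d) * real CARD('r)"
  define \<delta>' where "\<delta>' = \<delta> / (2 * B)"
  define N where "N = \<eta> * \<delta>'\<^sup>2 / (108 * B)"
  define r where "r = min (\<eta> * \<delta> / (6 * C * K)) (\<eta> * N / (3 * B * C\<^sup>2 * K))"
  have pos: "0 < B" "0 < \<delta>'" "0 < N" "0 < r"
    using \<delta> \<eta> C(1) K(1) by (auto simp: B_def \<delta>'_def N_def r_def)
  have "prob {\<omega>\<in>space M. \<delta> < norm (X t \<omega> - X s \<omega>)} \<le> \<eta>"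
    if st: "0 \<le> s" "s \<le> t" "t \<le> s + r" for s t
  proof -
    have t: "0 \<le> t" using st by simp
    define V where "V \<omega> = (LINT u:{s..t}|lborel. (1 + norm (X u \<omega>))\<^sup>2)" for \<omega>
    have V [measurable]: "V \<in> borel_measurable M"
      unfolding V_def by (rule time_integral_moment_bound[OF \<open>prob_space M\<close> X cont K(2)]) (use K st in auto)
    have VN: "prob {\<omega>\<in>space M. N < V \<omega>} \<le> K * r / N" if "0 < N" for N
    proof -
      have "prob {\<omega>\<in>space M. N < V \<omega>} \<le> K * (t - s) / N"
        unfolding V_def using that K st
        by (intro time_integral_moment_bound[OF \<open>prob_space M\<close> X cont K(2)]) auto
      also have "\<dots> \<le> K * r / N"
        using that K st by (intro divide_right_mono mult_left_mono) auto
      finally show ?thesis .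
    qed
    have [measurable]: "J i j t \<in> borel_measurable M" "J i j s \<in> borel_measurable M" for i j
      using ito[of j i] st t unfolding is_ito_integral_def conv_in_prob_def by blast+
    have Vint: "set_integrable lborel {s..t} (\<lambda>u. (1 + norm (X u \<omega>))\<^sup>2)" if "\<omega> \<in> space M" for \<omega>
      using st by (intro borel_integrable_atLeastAtMost' continuous_intros
          continuous_on_subset[OF cont[OF that]]) auto
    have J: "prob {\<omega>\<in>space M. \<delta>' < \<bar>J i j t \<omega> - J i j s \<omega>\<bar>} \<le> K * r / (N / C\<^sup>2) + 36 * N / \<delta>'\<^sup>2" for i j
    proof -
      interpret real_wiener M F "\<lambda>t \<omega>. w t \<omega> $ j"
        by (rule wiener_wrt_component[OF \<open>prob_space M\<close> w])
      have "AE \<omega> in M. \<forall>t\<ge>0. set_integrable lborel {0..t} (\<lambda>s. (a (X s \<omega>) $ i $ j)\<^sup>2)"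
        using ito[of j i] by (simp add: is_ito_integral_def)
      then have "AE \<omega> in M. (LINT u:{s..t}|lborel. (a (X u \<omega>) $ i $ j)\<^sup>2) \<le> C\<^sup>2 * V \<omega>"
        using AE_space
      proof eventually_elim
        case (elim \<omega>)
        have "set_integrable lborel {s..t} (\<lambda>s. (a (X s \<omega>) $ i $ j)\<^sup>2)"
          using st t elim by (intro set_integrable_subset[of lborel "{0..t}" _ "{s..t}"]) auto
        moreover have "(a (X u \<omega>) $ i $ j)\<^sup>2 \<le> C\<^sup>2 * (1 + norm (X u \<omega>))\<^sup>2" for u
        proof -
          have "\<bar>a (X u \<omega>) $ i $ j\<bar> \<le> C * (1 + norm (X u \<omega>))"
            using component_le_norm_cart[of "a (X u \<omega>) $ i" j] Finite_Cartesian_Product.norm_nth_le[of "a (X u \<omega>)" i]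
              C(3)[of "X u \<omega>"] by linarith
          then have "\<bar>a (X u \<omega>) $ i $ j\<bar>\<^sup>2 \<le> (C * (1 + norm (X u \<omega>)))\<^sup>2"
            by (intro power_mono) auto
          then show ?thesis
            by (simp add: power_mult_distrib)
        qed
        ultimately have "(LINT u:{s..t}|lborel. (a (X u \<omega>) $ i $ j)\<^sup>2) \<le>
            (LINT u:{s..t}|lborel. C\<^sup>2 * (1 + norm (X u \<omega>))\<^sup>2)"
          using Vint[of \<omega>] elim by (intro set_integral_mono) auto
        then show ?case
          by (simp add: V_def)
      qed
      then have "prob {\<omega>\<in>space M. \<delta>' < \<bar>J i j t \<omega> - J i j s \<omega>\<bar>} \<le>
          prob {\<omega>\<in>space M. N < C\<^sup>2 * V \<omega>} + 36 * N / \<delta>'\<^sup>2"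
        using pos st by (intro ito_integral_tail_bound[OF ito]) auto
      also have "{\<omega>\<in>space M. N < C\<^sup>2 * V \<omega>} = {\<omega>\<in>space M. N / C\<^sup>2 < V \<omega>}"
        using C(1) by (simp add: field_simps)
      also have "prob \<dots> \<le> K * r / (N / C\<^sup>2)"
        using C(1) pos by (intro VN) auto
      finally show ?thesis by simp
    qed
    let ?A = "\<lambda>p. {\<omega>\<in>space M. \<delta>' < \<bar>J (fst p) (snd p) t \<omega> - J (fst p) (snd p) s \<omega>\<bar>}"
    let ?U = "{\<omega>\<in>space M. \<delta> / (2 * C) < V \<omega>}"
    have "AE \<omega> in M. \<omega> \<in> {\<omega>\<in>space M. \<delta> < norm (X t \<omega> - X s \<omega>)} \<longrightarrow> \<omega> \<in> ?U \<union> (\<Union>p\<in>UNIV. ?A p)"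
      using sol[OF t] sol[OF st(1)] AE_space
    proof eventually_elim
      case (elim \<omega>)
      let ?b = "\<lambda>A. LINT u:A|lborel. b (X u \<omega>)"
      have bi: "set_integrable lborel {0..t} (\<lambda>u. b (X u \<omega>))"
        using elim by simp
      have i1: "set_integrable lborel {0..s} (\<lambda>u. b (X u \<omega>))" "set_integrable lborel {s<..t} (\<lambda>u. b (X u \<omega>))"
        using st by (auto intro!: set_integrable_subset[OF bi])
      have un: "{0..t} = {0..s} \<union> {s<..t}" "{0..s} \<inter> {s<..t} = {}"
        using st by auto
      have "?b {0..t} = ?b {0..s} + ?b {s<..t}"
        unfolding un(1) by (rule set_integral_Un[OF un(2) i1])
      then have D: "X t \<omega> - X s \<omega> = ?b {s<..t} + (\<chi> i. \<Sum>j\<in>UNIV. J i j t \<omega> - J i j s \<omega>)"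
        using elim by (simp add: vec_eq_iff sum_subtractf)
      have "norm (?b {s<..t}) \<le> (LINT u:{s<..t}|lborel. norm (b (X u \<omega>)))"
        by (rule set_integral_norm_bound[OF i1(2)])
      also have "\<dots> \<le> (LINT u:{s..t}|lborel. C * (1 + norm (X u \<omega>))\<^sup>2)"
        unfolding set_lebesgue_integral_def
      proof (rule integral_mono)
        show "integrable lborel (\<lambda>u. indicator {s<..t} u *\<^sub>R norm (b (X u \<omega>)))"
          using set_integrable_norm[OF i1(2)] by (simp add: set_integrable_def)
        show "integrable lborel (\<lambda>u. indicator {s..t} u *\<^sub>R (C * (1 + norm (X u \<omega>))\<^sup>2))"
          using set_integrable_mult_right[of C, OF Vint[of \<omega>]] elim by (simp add: set_integrable_def)
        fix u
        \<comment> \<open>Passing to the square lets the drift be bounded by the same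
          \<open>V\<close> as the stochastic integrals.\<close>
        have "1 + norm (X u \<omega>) \<le> (1 + norm (X u \<omega>))\<^sup>2"
          by (simp add: power2_eq_square algebra_simps)
        then have "C * (1 + norm (X u \<omega>)) \<le> C * (1 + norm (X u \<omega>))\<^sup>2"
          using C(1) by (intro mult_left_mono) auto
        then show "indicator {s<..t} u *\<^sub>R norm (b (X u \<omega>)) \<le>
            indicator {s..t} u *\<^sub>R (C * (1 + norm (X u \<omega>))\<^sup>2)"
          using order_trans[OF C(2)] C(1) by (auto simp: indicator_def)
      qed
      also have "\<dots> = C * V \<omega>"
        by (simp add: V_def)
      finally have nb: "norm (?b {s<..t}) \<le> C * V \<omega>" .
      show ?case
      proof (intro impI, rule ccontr)
        assume *: "\<omega> \<in> {\<omega>\<in>space M. \<delta> < norm (X t \<omega> - X s \<omega>)}" "\<omega> \<notin> ?U \<union> (\<Union>p\<in>UNIV. ?A p)"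
        then have Jle: "\<bar>J i j t \<omega> - J i j s \<omega>\<bar> \<le> \<delta>'" for i j
          by (force simp: not_less)
        have "norm (\<chi> i. \<Sum>j\<in>UNIV. J i j t \<omega> - J i j s \<omega>) \<le>
            (\<Sum>i\<in>UNIV. \<bar>(\<chi> i. \<Sum>j\<in>UNIV. J i j t \<omega> - J i j s \<omega>) $ i\<bar>)"
          by (rule norm_le_l1_cart)
        also have "\<dots> \<le> (\<Sum>i\<in>(UNIV::'d set). \<Sum>j\<in>(UNIV::'r set). \<delta>')"
          unfolding vec_lambda_beta by (intro sum_mono order_trans[OF sum_abs sum_mono[OF Jle]] order_refl)
        also have "\<dots> = \<delta> / 2"
          using pos by (simp add: \<delta>'_def B_def field_simps)
        finally have "norm (\<chi> i. \<Sum>j\<in>UNIV. J i j t \<omega> - J i j s \<omega>) \<le> \<delta> / 2" .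
        moreover have "C * V \<omega> \<le> \<delta> / 2"
          using * C(1) by (auto simp: field_simps not_less)
        ultimately have "norm (X t \<omega> - X s \<omega>) \<le> \<delta>"
          unfolding D using nb norm_triangle_ineq[of "?b {s<..t}" "\<chi> i. \<Sum>j\<in>UNIV. J i j t \<omega> - J i j s \<omega>"]
          by linarith
        with * show False by simp
      qed
    qed
    then have "prob {\<omega>\<in>space M. \<delta> < norm (X t \<omega> - X s \<omega>)} \<le> prob (?U \<union> (\<Union>p\<in>UNIV. ?A p))"
      by (intro finite_measure_mono_AE) auto
    also have "\<dots> \<le> prob ?U + prob (\<Union>p\<in>UNIV. ?A p)"
      by (intro measure_Un_le) auto
    also have "prob (\<Union>p\<in>UNIV. ?A p) \<le> (\<Sum>p\<in>UNIV. prob (?A p))"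
      by (intro finite_measure_subadditive_finite) auto
    also have "\<dots> \<le> (\<Sum>p\<in>(UNIV::('d \<times> 'r) set). K * r / (N / C\<^sup>2) + 36 * N / \<delta>'\<^sup>2)"
      by (intro sum_mono J)
    also have "\<dots> = B * (K * r / (N / C\<^sup>2)) + B * (36 * N / \<delta>'\<^sup>2)"
      by (simp add: B_def card_UNIV algebra_simps)
    also have "prob ?U \<le> K * r / (\<delta> / (2 * C))"
      using \<delta> C(1) by (intro VN) auto
    also have "K * r / (\<delta> / (2 * C)) \<le> \<eta> / 3"
    proof -
      have "r \<le> \<eta> * \<delta> / (6 * C * K)" by (simp add: r_def)
      then show ?thesis using \<delta> C(1) K(1) by (simp add: field_simps)
    qed
    also have "B * (K * r / (N / C\<^sup>2)) \<le> \<eta> / 3"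
    proof -
      have "r \<le> \<eta> * N / (3 * B * C\<^sup>2 * K)" by (simp add: r_def)
      then show ?thesis using pos C(1) K(1) by (simp add: field_simps)
    qed
    also have "B * (36 * N / \<delta>'\<^sup>2) = \<eta> / 3"
      using pos by (simp add: N_def field_simps)
    finally show ?thesis by simp
  qed
  with pos show ?thesis by blast
qed

lemma power4_add_le:
  fixes x y :: real
  shows "(x + y) ^ 4 \<le> 8 * (x ^ 4 + y ^ 4)"
proof -
  have sq: "(p + q)\<^sup>2 \<le> 2 * (p\<^sup>2 + q\<^sup>2)" for p q :: real
    using zero_le_power2[of "p - q"] by (simp add: power2_eq_square algebra_simps)
  have "(x + y) ^ 4 = ((x + y)\<^sup>2)\<^sup>2"
    by simp
  also have "\<dots> \<le> (2 * (x\<^sup>2 + y\<^sup>2))\<^sup>2"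
    by (intro power_mono sq) simp
  also have "\<dots> = 4 * (x\<^sup>2 + y\<^sup>2)\<^sup>2"
    unfolding power_mult_distrib by simp
  also have "\<dots> \<le> 4 * (2 * ((x\<^sup>2)\<^sup>2 + (y\<^sup>2)\<^sup>2))"
    by (intro mult_left_mono sq) simp
  finally show ?thesis
    by simp
qed

text \<open>A deliberately crude estimate from \<open>x\<^sup>2 \<le> 1 + x ^ 4\<close>: later
  arguments use only that the second moments are finite and, for the noise, bounded independently of
  the index.\<close>

lemma (in prob_space) square_norm_diff_moment:
  fixes f g :: "'a \<Rightarrow> 'b :: euclidean_space"
  assumes [measurable]: "f \<in> borel_measurable M" "g \<in> borel_measurable M"
    and int: "integrable M (\<lambda>\<omega>. norm (f \<omega>) ^ 4)" "integrable M (\<lambda>\<omega>. norm (g \<omega>) ^ 4)"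
  shows "integrable M (\<lambda>\<omega>. (norm (f \<omega> - g \<omega>))\<^sup>2)"
    and "expectation (\<lambda>\<omega>. (norm (f \<omega> - g \<omega>))\<^sup>2) \<le>
      1 + 8 * (expectation (\<lambda>\<omega>. norm (f \<omega>) ^ 4) + expectation (\<lambda>\<omega>. norm (g \<omega>) ^ 4))"
proof -
  let ?B = "\<lambda>\<omega>. 1 + 8 * (norm (f \<omega>) ^ 4 + norm (g \<omega>) ^ 4)"
  have B: "integrable M ?B"
    using int by simp
  have sq: "x\<^sup>2 \<le> 1 + x ^ 4" for x :: real
  proof -
    have "(x\<^sup>2 - 1)\<^sup>2 = x ^ 4 - 2 * x\<^sup>2 + 1"
      by (simp add: power2_eq_square power4_eq_xxxx algebra_simps)
    then show ?thesis
      using zero_le_power2[of "x\<^sup>2 - 1"] zero_le_power2[of x] by linarith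
  qed
  have le: "(norm (f \<omega> - g \<omega>))\<^sup>2 \<le> ?B \<omega>" for \<omega>
    by (rule order_trans[OF sq] add_left_mono order_trans[OF power_mono[OF norm_triangle_ineq4]] power4_add_le norm_ge_zero)+
  show i: "integrable M (\<lambda>\<omega>. (norm (f \<omega> - g \<omega>))\<^sup>2)"
    using order_trans[OF le abs_ge_self]
    by (intro Bochner_Integration.integrable_bound[OF B]) (auto intro!: AE_I2)
  have "expectation (\<lambda>\<omega>. (norm (f \<omega> - g \<omega>))\<^sup>2) \<le> expectation ?B"
    by (intro integral_mono i B le)
  then show "expectation (\<lambda>\<omega>. (norm (f \<omega> - g \<omega>))\<^sup>2) \<le>
      1 + 8 * (expectation (\<lambda>\<omega>. norm (f \<omega>) ^ 4) + expectation (\<lambda>\<omega>. norm (g \<omega>) ^ 4))"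
    using int by (simp add: prob_space)
qed

text \<open>Uniform integrability in explicit form. Where the increment is at most \<delta>, its
  square is at most \<open>\<delta>\<^sup>2\<close>; elsewhere the inequality
  \<open>x\<^sup>2 \<le> x ^ 4 / R + R\<close> leaves a term controlled by fourth moments and
  \<open>R\<close> times the probability of a large increment.\<close>

lemma sde_increment_L2:
  fixes X :: "real \<Rightarrow> 'a \<Rightarrow> real ^ 'd" and w :: "real \<Rightarrow> 'a \<Rightarrow> real ^ 'r"
  assumes "prob_space M" and sde: "sde_solution M w b a x0 X"
    and C: "0 < C" "\<And>x. norm (b x) \<le> C * (1 + norm x)" "\<And>x. norm (a x) \<le> C * (1 + norm x)"
    and K: "0 < K" "\<And>t. 0 \<le> t \<Longrightarrow> (\<integral>\<^sup>+\<omega>. ennreal (norm (X t \<omega>) ^ 4) \<partial>M) \<le> ennreal K"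
    and X: "\<And>t. 0 \<le> t \<Longrightarrow> X t \<in> borel_measurable M"
    and \<eta>: "0 < \<eta>"
  shows "\<exists>r>0. \<forall>s t. 0 \<le> s \<and> s \<le> t \<and> t \<le> s + r \<longrightarrow>
    (\<integral>\<omega>. (norm (X t \<omega> - X s \<omega>))\<^sup>2 \<partial>M) \<le> \<eta>"
proof -
  interpret prob_space M by fact
  have X4: "integrable M (\<lambda>\<omega>. norm (X t \<omega>) ^ 4)" "(\<integral>\<omega>. norm (X t \<omega>) ^ 4 \<partial>M) \<le> K" if "0 \<le> t" for t
    using integrable_nn_integral_le[OF _ _ K(2)[OF that]] X[OF that] K(1) by auto
  have K2: "(\<integral>\<^sup>+\<omega>. ennreal ((1 + norm (X t \<omega>))\<^sup>2) \<partial>M) \<le> ennreal (4 + K)" if "0 \<le> t" for t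
  proof -
    have [measurable]: "X t \<in> borel_measurable M" by (rule X[OF that])
    have "(1 + x)\<^sup>2 \<le> 4 + x ^ 4" for x :: real
    proof -
      \<comment> \<open>This sum is exactly the right side minus the left side of the inequality to
        be shown.\<close>
      have "(x\<^sup>2 - 1)\<^sup>2 + (x - 1)\<^sup>2 + 1 \<ge> 0" by simp
      then show ?thesis by (simp add: power2_eq_square power4_eq_xxxx algebra_simps)
    qed
    then have "(\<integral>\<^sup>+\<omega>. ennreal ((1 + norm (X t \<omega>))\<^sup>2) \<partial>M) \<le> (\<integral>\<^sup>+\<omega>. ennreal 4 + ennreal (norm (X t \<omega>) ^ 4) \<partial>M)"
      by (intro nn_integral_mono) (simp add: ennreal_leI flip: ennreal_plus ennreal_numeral)
    also have "\<dots> = ennreal 4 + (\<integral>\<^sup>+\<omega>. ennreal (norm (X t \<omega>) ^ 4) \<partial>M)"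
      by (subst nn_integral_add) (auto simp: emeasure_space_1)
    also have "\<dots> \<le> ennreal (4 + K)"
      using K(2)[OF that] K(1) by (simp add: ennreal_plus)
    finally show ?thesis .
  qed
  \<comment> \<open>Each of the three contributions is given \<open>\<eta> / 3\<close>:
    \<open>\<delta>\<^sup>2\<close> directly, the fourth moments because
    \<open>8 * (K + K) / R\<close> equals \<open>\<eta> / 3\<close> for this \<open>R\<close>, and
    the large increments because their probability is made at most
    \<open>\<eta> / (3 * R)\<close>.\<close>
  define \<delta> where "\<delta> = sqrt (\<eta> / 3)"
  define R where "R = 48 * K / \<eta>"
  have pos: "0 < \<delta>" "0 < R" "\<delta>\<^sup>2 = \<eta> / 3"
    using \<eta> K(1) by (auto simp: \<delta>_def R_def)
  obtain r where r: "0 < r" "\<And>s t. 0 \<le> s \<Longrightarrow> s \<le> t \<Longrightarrow> t \<le> s + r \<Longrightarrow>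
      prob {\<omega>\<in>space M. \<delta> < norm (X t \<omega> - X s \<omega>)} \<le> \<eta> / (3 * R)"
    using sde_increment_tail[OF assms(1,2) C, of "4 + K" \<delta> "\<eta> / (3 * R)"] K2 K(1) pos \<eta> by auto
  have "(\<integral>\<omega>. (norm (X t \<omega> - X s \<omega>))\<^sup>2 \<partial>M) \<le> \<eta>"
    if st: "0 \<le> s" "s \<le> t" "t \<le> s + r" for s t
  proof -
    have t: "0 \<le> t" using st by simp
    have [measurable]: "X t \<in> borel_measurable M" "X s \<in> borel_measurable M"
      using X st t by auto
    let ?A = "{\<omega>\<in>space M. \<delta> < norm (X t \<omega> - X s \<omega>)}"
    let ?f = "\<lambda>\<omega>. \<delta>\<^sup>2 + 8 * (norm (X t \<omega>) ^ 4 + norm (X s \<omega>) ^ 4) / R + R * indicator ?A \<omega>"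
    have ind: "integrable M (indicator ?A :: 'a \<Rightarrow> real)"
      by (rule integrable_real_indicator) (auto simp: less_top[symmetric])
    have f: "integrable M ?f"
      using X4 t st by (intro Bochner_Integration.integrable_add integrable_divide integrable_mult_right ind) auto
    have le: "(norm (X t \<omega> - X s \<omega>))\<^sup>2 \<le> ?f \<omega>" if "\<omega> \<in> space M" for \<omega>
    proof -
      let ?x = "norm (X t \<omega> - X s \<omega>)"
      have "?x ^ 4 \<le> (norm (X t \<omega>) + norm (X s \<omega>)) ^ 4"
        by (intro power_mono norm_triangle_ineq4) simp
      also have "\<dots> \<le> 8 * (norm (X t \<omega>) ^ 4 + norm (X s \<omega>) ^ 4)"
        by (rule power4_add_le)
      finally have x4: "?x ^ 4 / R \<le> 8 * (norm (X t \<omega>) ^ 4 + norm (X s \<omega>) ^ 4) / R"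
        using pos by (intro divide_right_mono) auto
      show ?thesis
      proof (cases "\<delta> < ?x")
        case False
        then have "?x\<^sup>2 \<le> \<delta>\<^sup>2" by (intro power_mono) auto
        moreover have "0 \<le> 8 * (norm (X t \<omega>) ^ 4 + norm (X s \<omega>) ^ 4) / R"
          using pos by (intro divide_nonneg_pos) auto
        ultimately show ?thesis using False by simp
      next
        case True
        have "R * ?x\<^sup>2 \<le> ?x ^ 4 + R * R"
        proof -
          have "(?x\<^sup>2 - R)\<^sup>2 = ?x ^ 4 - 2 * (R * ?x\<^sup>2) + R * R"
            by (simp add: power2_eq_square power4_eq_xxxx algebra_simps)
          moreover have "0 \<le> R * ?x\<^sup>2"
            using pos by simp
          ultimately show ?thesis
            using zero_le_power2[of "?x\<^sup>2 - R"] by linarith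
        qed
        then have "?x\<^sup>2 \<le> ?x ^ 4 / R + R"
          using pos by (simp add: field_simps)
        also have "\<dots> \<le> ?f \<omega>"
          using x4 True that add_increasing[OF zero_le_power2[of \<delta>] x4] by simp
        finally show ?thesis .
      qed
    qed
    have i: "integrable M (\<lambda>\<omega>. (norm (X t \<omega> - X s \<omega>))\<^sup>2)"
      using X4 t st by (intro square_norm_diff_moment(1)) auto
    have "(\<integral>\<omega>. (norm (X t \<omega> - X s \<omega>))\<^sup>2 \<partial>M) \<le> (\<integral>\<omega>. ?f \<omega> \<partial>M)"
      using le by (intro integral_mono i f) auto
    also have "\<dots> = \<delta>\<^sup>2 + 8 * ((\<integral>\<omega>. norm (X t \<omega>) ^ 4 \<partial>M) + (\<integral>\<omega>. norm (X s \<omega>) ^ 4 \<partial>M)) / R + R * prob ?A"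
      using X4 t st ind by (simp add: prob_space)
    also have "\<dots> \<le> \<delta>\<^sup>2 + 8 * (K + K) / R + R * (\<eta> / (3 * R))"
      using X4 t st pos r(2)[OF st] by (intro add_mono divide_right_mono mult_left_mono) auto
    also have "\<dots> = \<eta>"
      using pos \<eta> K(1) by (simp add: R_def field_simps)
    finally show ?thesis .
  qed
  with r(1) show ?thesis by blast
qed

section \<open>Second moments of one-dependent sums and the empirical noise covariance\<close>

context prob_space
begin

lemma indep_var_restrict_compose:
  assumes ind: "indep_vars (\<lambda>_. borel) Z I" and AB: "A \<inter> B = {}" "A \<subseteq> I" "B \<subseteq> I"
    and f: "f \<in> borel_measurable (PiM A (\<lambda>_. borel))" and g: "g \<in> borel_measurable (PiM B (\<lambda>_. borel))"
  shows "indep_var borel (\<lambda>\<omega>. f (restrict (\<lambda>i. Z i \<omega>) A)) borel (\<lambda>\<omega>. g (restrict (\<lambda>i. Z i \<omega>) B))"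
  using indep_var_compose[OF indep_var_restrict[OF ind AB] f g] by (simp add: comp_def)

text \<open>The Cauchy-Schwarz inequality against the constant 1, read off from the nonnegative
  variance of the absolute value of \<open>f\<close>.\<close>

lemma expectation_abs_le_sqrt:
  fixes f :: "'a \<Rightarrow> real"
  assumes "f \<in> borel_measurable M" "integrable M (\<lambda>\<omega>. (f \<omega>)\<^sup>2)"
  shows "integrable M f" "expectation (\<lambda>\<omega>. \<bar>f \<omega>\<bar>) \<le> sqrt (expectation (\<lambda>\<omega>. (f \<omega>)\<^sup>2))"
proof -
  show i: "integrable M f"
    using assms by (rule square_integrable_imp_integrable)
  then have "variance (\<lambda>\<omega>. \<bar>f \<omega>\<bar>) = expectation (\<lambda>\<omega>. (f \<omega>)\<^sup>2) - (expectation (\<lambda>\<omega>. \<bar>f \<omega>\<bar>))\<^sup>2"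
    using assms by (subst variance_eq) auto
  then have "(expectation (\<lambda>\<omega>. \<bar>f \<omega>\<bar>))\<^sup>2 \<le> expectation (\<lambda>\<omega>. (f \<omega>)\<^sup>2)"
    using variance_positive[of "\<lambda>\<omega>. \<bar>f \<omega>\<bar>"] by simp
  then show "expectation (\<lambda>\<omega>. \<bar>f \<omega>\<bar>) \<le> sqrt (expectation (\<lambda>\<omega>. (f \<omega>)\<^sup>2))"
    by (rule real_le_rsqrt)
qed

text \<open>In the double sum of \<open>D i * D j\<close>, each \<open>i\<close> has at most three
  indices \<open>j\<close> with a possibly nonzero expectation, and AM-GM bounds each of these by
  \<open>B\<close>. The second moment thus grows linearly in \<open>n\<close>, not
  quadratically.\<close>

lemma one_dependent_sum_second_moment:
  fixes D :: "nat \<Rightarrow> 'a \<Rightarrow> real"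
  assumes [measurable]: "\<And>i. i < n \<Longrightarrow> D i \<in> borel_measurable M"
    and sq: "\<And>i. i < n \<Longrightarrow> integrable M (\<lambda>\<omega>. (D i \<omega>)\<^sup>2)"
    and B: "\<And>i. i < n \<Longrightarrow> expectation (\<lambda>\<omega>. (D i \<omega>)\<^sup>2) \<le> B"
    and zero: "\<And>i j. j < n \<Longrightarrow> Suc i < j \<Longrightarrow> expectation (\<lambda>\<omega>. D i \<omega> * D j \<omega>) = 0"
  shows "integrable M (\<lambda>\<omega>. (\<Sum>i<n. D i \<omega>)\<^sup>2)"
    and "expectation (\<lambda>\<omega>. (\<Sum>i<n. D i \<omega>)\<^sup>2) \<le> 3 * real n * B"
proof -
  have am: "\<bar>x * y\<bar> \<le> (x\<^sup>2 + y\<^sup>2) / 2" for x y :: real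
    using sum_squares_bound[of "\<bar>x\<bar>" "\<bar>y\<bar>"] by (simp add: abs_mult)
  have int: "integrable M (\<lambda>\<omega>. D i \<omega> * D j \<omega>)" if "i < n" "j < n" for i j
  proof (rule Bochner_Integration.integrable_bound)
    show "integrable M (\<lambda>\<omega>. ((D i \<omega>)\<^sup>2 + (D j \<omega>)\<^sup>2) / 2)"
      using sq that by simp
    show "AE \<omega> in M. norm (D i \<omega> * D j \<omega>) \<le> norm (((D i \<omega>)\<^sup>2 + (D j \<omega>)\<^sup>2) / 2)"
      using am by (auto intro: order_trans)
  qed (use that in measurable)
  have le: "expectation (\<lambda>\<omega>. D i \<omega> * D j \<omega>) \<le> B" if "i < n" "j < n" for i j
  proof -
    have "expectation (\<lambda>\<omega>. D i \<omega> * D j \<omega>) \<le> expectation (\<lambda>\<omega>. ((D i \<omega>)\<^sup>2 + (D j \<omega>)\<^sup>2) / 2)"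
      using sq that int order_trans[OF abs_ge_self am] by (intro integral_mono) auto
    also have "\<dots> = (expectation (\<lambda>\<omega>. (D i \<omega>)\<^sup>2) + expectation (\<lambda>\<omega>. (D j \<omega>)\<^sup>2)) / 2"
      using sq that by simp
    also have "\<dots> \<le> B"
      using B[OF that(1)] B[OF that(2)] by simp
    finally show ?thesis .
  qed
  have eq: "(\<Sum>i<n. D i \<omega>)\<^sup>2 = (\<Sum>i<n. \<Sum>j<n. D i \<omega> * D j \<omega>)" for \<omega>
    by (simp add: power2_eq_square sum_product)
  show "integrable M (\<lambda>\<omega>. (\<Sum>i<n. D i \<omega>)\<^sup>2)"
    unfolding eq by (intro Bochner_Integration.integrable_sum int) auto
  have "expectation (\<lambda>\<omega>. (\<Sum>i<n. D i \<omega>)\<^sup>2) = (\<Sum>i<n. \<Sum>j<n. expectation (\<lambda>\<omega>. D i \<omega> * D j \<omega>))"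
    unfolding eq
    by (subst Bochner_Integration.integral_sum)
       (auto intro!: sum.cong Bochner_Integration.integral_sum Bochner_Integration.integrable_sum int)
  also have "\<dots> \<le> (\<Sum>i<n. 3 * B)"
  proof (rule sum_mono)
    fix i assume "i \<in> {..<n}"
    then have i: "i < n" by simp
    have B0: "0 \<le> B"
      by (rule order_trans[OF Bochner_Integration.integral_nonneg B[OF i]]) simp
    \<comment> \<open>At \<open>i\<close> = 0 truncated subtraction makes \<open>i - 1\<close>
      coincide with \<open>i\<close>; this is harmless because only the upper bound 3 on the
      cardinality is used.\<close>
    let ?N = "{..<n} \<inter> {i - 1, i, Suc i}"
    have "(\<Sum>j<n. expectation (\<lambda>\<omega>. D i \<omega> * D j \<omega>)) = (\<Sum>j\<in>?N. expectation (\<lambda>\<omega>. D i \<omega> * D j \<omega>))"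
    proof (rule sum.mono_neutral_right)
      show "\<forall>j\<in>{..<n} - ?N. expectation (\<lambda>\<omega>. D i \<omega> * D j \<omega>) = 0"
      proof
        fix j assume "j \<in> {..<n} - ?N"
        then have "j < n" and "Suc i < j \<or> Suc j < i"
          by auto
        then show "expectation (\<lambda>\<omega>. D i \<omega> * D j \<omega>) = 0"
          using zero[of j i] zero[of i j] i by (auto simp: mult.commute)
      qed
    qed auto
    also have "\<dots> \<le> real (card ?N) * B"
      using le i by (intro sum_bounded_above) auto
    also have "\<dots> \<le> 3 * B"
    proof (rule mult_right_mono)
      have "card ?N \<le> card {i - 1, i, Suc i}"
        by (rule card_mono) auto
      also have "\<dots> \<le> 3"
        by (auto simp: card_insert_if)
      finally show "real (card ?N) \<le> 3" by simp
    qed fact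
    finally show "(\<Sum>j<n. expectation (\<lambda>\<omega>. D i \<omega> * D j \<omega>)) \<le> 3 * B" .
  qed
  finally show "expectation (\<lambda>\<omega>. (\<Sum>i<n. D i \<omega>)\<^sup>2) \<le> 3 * real n * B"
    by simp
qed

text \<open>\<open>Z\<close> is an average of the centred products \<open>?D i\<close>. Each is
  built from the noise at times \<open>i\<close> and \<open>Suc i\<close> only, so products two or
  more steps apart are independent. In the mean of a product of increments the two equal-time terms
  give \<open>mat 1 $ k $ l\<close> each and the mixed ones vanish, whence the centring
  \<open>?c\<close> and the factor 2 in the normalisation. The constant \<open>32 * K + 8\<close>
  bounds the second moment of \<open>?D i\<close>: 16 times two fourth moments, plus 8 from the
  centring. The factor 3 stems from one-dependence.\<close>

lemma noise_increment_products:
  fixes e :: "nat \<Rightarrow> 'a \<Rightarrow> real ^ 'd" and k l :: 'd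
  assumes meas [measurable]: "\<And>i. i \<le> n \<Longrightarrow> e i \<in> borel_measurable M"
    and indep: "indep_sets (source_sets M w x0 e) {Noise i j |i j. i \<le> n}"
    and mean: "\<And>i. i \<le> n \<Longrightarrow> integrable M (e i)" "\<And>i. i \<le> n \<Longrightarrow> expectation (e i) = 0"
    and cov: "\<And>i. i \<le> n \<Longrightarrow> integrable M (\<lambda>\<omega>. outer (e i \<omega>))"
      "\<And>i. i \<le> n \<Longrightarrow> expectation (\<lambda>\<omega>. outer (e i \<omega>)) = mat 1"
    and K: "\<And>i. i \<le> n \<Longrightarrow> integrable M (\<lambda>\<omega>. norm (e i \<omega>) ^ 4)"
      "\<And>i. i \<le> n \<Longrightarrow> expectation (\<lambda>\<omega>. norm (e i \<omega>) ^ 4) \<le> K"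
    and n: "0 < n"
  defines "Z \<equiv> \<lambda>\<omega>. (1 / (2 * real n)) *
    (\<Sum>i<n. (e (Suc i) \<omega> - e i \<omega>) $ k * (e (Suc i) \<omega> - e i \<omega>) $ l) - mat 1 $ k $ l"
  shows "integrable M Z" "expectation (\<lambda>\<omega>. \<bar>Z \<omega>\<bar>) \<le> sqrt (3 * (32 * K + 8) / (4 * real n))"
proof -
  let ?c = "2 * mat 1 $ k $ l :: real"
  let ?d = "\<lambda>i \<omega>. e (Suc i) \<omega> - e i \<omega>"
  let ?D = "\<lambda>i \<omega>. ?d i \<omega> $ k * ?d i \<omega> $ l - ?c"
  \<comment> \<open>One scalar family indexed by the sources, so that disjoint blocks of indices
    yield independent variables. \<open>Driver\<close> and \<open>Initial\<close> receive the dummy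
    value 0; they lie outside the index set used here.\<close>
  define z where "z p \<omega> = (case p of Noise i j \<Rightarrow> e i \<omega> $ j | _ \<Rightarrow> 0)" for p \<omega>
  have z_Noise: "z (Noise i j) = (\<lambda>\<omega>. e i \<omega> $ j)" for i j
    by (simp add: z_def fun_eq_iff)
  have ind: "indep_vars (\<lambda>_. borel) z {Noise i j |i (j::'d). i \<le> n}"
    unfolding indep_vars_def2
  proof (intro conjI ballI)
    fix p assume "p \<in> {Noise i j |i (j::'d). i \<le> n}"
    then show "random_variable borel (z p)"
      unfolding z_def by auto
  next
    show "indep_sets (\<lambda>p. {z p -` A \<inter> space M |A. A \<in> sets borel}) {Noise i j |i (j::'d). i \<le> n}"
      by (rule indep_sets_mono_sets[OF indep])
         (auto 0 0 simp: z_Noise generated_by_def sets_vimage_algebra intro!: sigma_sets.Basic exI conjI)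
  qed
  have c: "\<bar>?c\<bar> \<le> 2"
    by (simp add: mat_def)
  have comp: "integrable M (\<lambda>\<omega>. e i \<omega> $ j)" "expectation (\<lambda>\<omega>. e i \<omega> $ j) = 0" if "i \<le> n" for i j
    using integrable_bounded_linear[OF bounded_linear_vec_nth mean(1)[OF that]]
      integral_bounded_linear[OF bounded_linear_vec_nth mean(1)[OF that], of j] mean(2)[OF that]
    by auto
  have BL: "bounded_linear (\<lambda>A :: real ^ 'd ^ 'd. A $ k $ l)"
    by (rule bounded_linear_compose[OF bounded_linear_vec_nth bounded_linear_vec_nth])
  have same: "integrable M (\<lambda>\<omega>. e i \<omega> $ k * e i \<omega> $ l)"
    "expectation (\<lambda>\<omega>. e i \<omega> $ k * e i \<omega> $ l) = mat 1 $ k $ l" if "i \<le> n" for i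
    using integrable_bounded_linear[OF BL cov(1)[OF that]]
      integral_bounded_linear[OF BL cov(1)[OF that]] cov(2)[OF that]
    by (auto simp: outer_def)
  have cross: "integrable M (\<lambda>\<omega>. e i \<omega> $ p * e j \<omega> $ q)" "expectation (\<lambda>\<omega>. e i \<omega> $ p * e j \<omega> $ q) = 0"
    if "i \<le> n" "j \<le> n" "i \<noteq> j" for i j p q
  proof -
    have I: "indep_var borel (\<lambda>\<omega>. e i \<omega> $ p) borel (\<lambda>\<omega>. e j \<omega> $ q)"
      using that indep_var_restrict_compose[OF ind, of "{Noise i p}" "{Noise j q}"
          "\<lambda>x. x (Noise i p)" "\<lambda>x. x (Noise j q)"]
      by (auto simp: z_def)
    show "integrable M (\<lambda>\<omega>. e i \<omega> $ p * e j \<omega> $ q)" "expectation (\<lambda>\<omega>. e i \<omega> $ p * e j \<omega> $ q) = 0"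
      using indep_var_lebesgue_integral[OF I] indep_var_integrable[OF I] comp that by auto
  qed
  have D_meas [measurable]: "?D i \<in> borel_measurable M" if "i < n" for i
  proof -
    have [measurable]: "e i \<in> borel_measurable M" "e (Suc i) \<in> borel_measurable M"
      using meas that by auto
    show ?thesis by measurable
  qed
  have D_le: "(?D i \<omega>)\<^sup>2 \<le> 16 * (norm (e (Suc i) \<omega>) ^ 4 + norm (e i \<omega>) ^ 4) + 8" for i \<omega>
  proof -
    have "(x - y)\<^sup>2 \<le> 2 * x\<^sup>2 + 2 * y\<^sup>2" for x y :: real
      using zero_le_power2[of "x + y"] by (simp add: power2_eq_square algebra_simps)
    then have "(?D i \<omega>)\<^sup>2 \<le> 2 * (?d i \<omega> $ k * ?d i \<omega> $ l)\<^sup>2 + 2 * ?c\<^sup>2" .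
    moreover have "?c\<^sup>2 \<le> 2\<^sup>2"
      using c by (subst abs_le_square_iff[symmetric]) simp
    moreover have "(?d i \<omega> $ k * ?d i \<omega> $ l)\<^sup>2 \<le> norm (?d i \<omega>) ^ 4"
    proof -
      have "\<bar>?d i \<omega> $ k * ?d i \<omega> $ l\<bar> \<le> norm (?d i \<omega>) * norm (?d i \<omega>)"
        unfolding abs_mult by (intro mult_mono component_le_norm_cart) auto
      then have "\<bar>?d i \<omega> $ k * ?d i \<omega> $ l\<bar>\<^sup>2 \<le> (norm (?d i \<omega>) * norm (?d i \<omega>))\<^sup>2"
        by (rule power_mono) simp
      then show ?thesis
        by (simp add: power2_eq_square power4_eq_xxxx mult.assoc)
    qed
    moreover have "norm (?d i \<omega>) ^ 4 \<le> 8 * (norm (e (Suc i) \<omega>) ^ 4 + norm (e i \<omega>) ^ 4)"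
      by (rule order_trans[OF power_mono[OF norm_triangle_ineq4] power4_add_le]) simp
    ultimately show ?thesis by (simp add: algebra_simps)
  qed
  have bound_int: "integrable M (\<lambda>\<omega>. 16 * (norm (e (Suc i) \<omega>) ^ 4 + norm (e i \<omega>) ^ 4) + 8)" if "i < n" for i
    using K(1) that by simp
  have D_sq: "integrable M (\<lambda>\<omega>. (?D i \<omega>)\<^sup>2)" if "i < n" for i
  proof (rule Bochner_Integration.integrable_bound[OF bound_int[OF that]])
    show "(\<lambda>\<omega>. (?D i \<omega>)\<^sup>2) \<in> borel_measurable M"
      using D_meas[OF that] by measurable
    show "AE \<omega> in M. norm ((?D i \<omega>)\<^sup>2) \<le> norm (16 * (norm (e (Suc i) \<omega>) ^ 4 + norm (e i \<omega>) ^ 4) + 8)"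
      using order_trans[OF D_le abs_ge_self] by (intro AE_I2) simp
  qed
  have D_B: "expectation (\<lambda>\<omega>. (?D i \<omega>)\<^sup>2) \<le> 32 * K + 8" if "i < n" for i
  proof -
    have "expectation (\<lambda>\<omega>. (?D i \<omega>)\<^sup>2) \<le>
        expectation (\<lambda>\<omega>. 16 * (norm (e (Suc i) \<omega>) ^ 4 + norm (e i \<omega>) ^ 4) + 8)"
      by (intro integral_mono D_sq bound_int D_le that)
    also have "\<dots> = 16 * (expectation (\<lambda>\<omega>. norm (e (Suc i) \<omega>) ^ 4) + expectation (\<lambda>\<omega>. norm (e i \<omega>) ^ 4)) + 8"
      using K(1) that by (simp add: prob_space)
    also have "\<dots> \<le> 32 * K + 8"
      using K(2)[of i] K(2)[of "Suc i"] that by simp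
    finally show ?thesis .
  qed
  have D_int: "integrable M (?D i)" if "i < n" for i
    using expectation_abs_le_sqrt(1)[OF D_meas[OF that] D_sq[OF that]] .
  have D_mean: "expectation (?D i) = 0" if "i < n" for i
  proof -
    have eq: "?D i = (\<lambda>\<omega>. e (Suc i) \<omega> $ k * e (Suc i) \<omega> $ l + e i \<omega> $ k * e i \<omega> $ l -
        e (Suc i) \<omega> $ k * e i \<omega> $ l - e i \<omega> $ k * e (Suc i) \<omega> $ l - ?c)"
      by (simp add: algebra_simps)
    show ?thesis
      unfolding eq using that same[of i] same[of "Suc i"] cross[of i "Suc i"] cross[of "Suc i" i]
      by (simp add: prob_space)
  qed
  have D_zero: "expectation (\<lambda>\<omega>. ?D i \<omega> * ?D j \<omega>) = 0" if "j < n" "Suc i < j" for i j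
  proof -
    \<comment> \<open>The blocks of \<open>i\<close> and \<open>j\<close> are disjoint because
      \<open>Suc i < j\<close>; for adjacent indices they would share the noise at time
      \<open>j\<close>.\<close>
    let ?A = "\<lambda>i. {Noise i k, Noise i l, Noise (Suc i) k, Noise (Suc i) l}"
    let ?f = "\<lambda>i x. (x (Noise (Suc i) k) - x (Noise i k)) * (x (Noise (Suc i) l) - x (Noise i l)) - ?c"
    have f: "?f i \<in> borel_measurable (PiM (?A i) (\<lambda>_. borel))" for i
      by (intro borel_measurable_diff borel_measurable_times measurable_component_singleton) auto
    have "indep_var borel (\<lambda>\<omega>. ?f i (restrict (\<lambda>p. z p \<omega>) (?A i)))
        borel (\<lambda>\<omega>. ?f j (restrict (\<lambda>p. z p \<omega>) (?A j)))"
      using that by (intro indep_var_restrict_compose[OF ind _ _ _ f f]) auto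
    then have I: "indep_var borel (?D i) borel (?D j)"
      by (simp add: z_def)
    show ?thesis
      using indep_var_lebesgue_integral[OF I D_int D_int] D_mean that by simp
  qed
  note sum = one_dependent_sum_second_moment[where D="?D" and n=n and B="32 * K + 8",
      OF D_meas D_sq D_B D_zero]
  have Z: "Z = (\<lambda>\<omega>. (1 / (2 * real n)) * (\<Sum>i<n. ?D i \<omega>))"
    unfolding Z_def using n by (simp add: sum_subtractf right_diff_distrib)
  have [measurable]: "Z \<in> borel_measurable M"
    unfolding Z using D_meas by measurable
  have Z2: "(\<lambda>\<omega>. (Z \<omega>)\<^sup>2) = (\<lambda>\<omega>. (1 / (2 * real n))\<^sup>2 * (\<Sum>i<n. ?D i \<omega>)\<^sup>2)"
    unfolding Z by (simp only: power_mult_distrib)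
  have Zi: "integrable M (\<lambda>\<omega>. (Z \<omega>)\<^sup>2)"
    unfolding Z2 using sum(1) by simp
  show "integrable M Z"
    by (rule expectation_abs_le_sqrt(1)[OF _ Zi]) simp
  have "expectation (\<lambda>\<omega>. (Z \<omega>)\<^sup>2) \<le> (1 / (2 * real n))\<^sup>2 * (3 * real n * (32 * K + 8))"
    unfolding Z2 using sum by (auto intro!: mult_left_mono)
  also have "\<dots> = 3 * (32 * K + 8) / (4 * real n)"
    using n by (simp add: power2_eq_square field_simps)
  finally have "sqrt (expectation (\<lambda>\<omega>. (Z \<omega>)\<^sup>2)) \<le> sqrt (3 * (32 * K + 8) / (4 * real n))"
    by (rule real_sqrt_le_mono)
  with expectation_abs_le_sqrt(2)[OF _ Zi]
  show "expectation (\<lambda>\<omega>. \<bar>Z \<omega>\<bar>) \<le> sqrt (3 * (32 * K + 8) / (4 * real n))"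
    by (rule order_trans) simp
qed

section \<open>Convergence of the estimator\<close>

text \<open>The Euclidean norm of a matrix is at most the sum of its absolute entries, so Markov's
  inequality reduces convergence in probability to L1 convergence of each entry.\<close>

lemma conv_in_prob_matrixI:
  fixes U :: "nat \<Rightarrow> 'a \<Rightarrow> real ^ 'm ^ 'n"
  assumes meas [measurable]: "\<And>n. U n \<in> borel_measurable M"
    and int: "\<And>n p q. integrable M (\<lambda>\<omega>. U n \<omega> $ p $ q)"
    and lim: "\<And>p q. (\<lambda>n. expectation (\<lambda>\<omega>. \<bar>U n \<omega> $ p $ q - L $ p $ q\<bar>)) \<longlonglongrightarrow> 0"
  shows "conv_in_prob M U (\<lambda>_. L) sequentially"
  unfolding conv_in_prob_def
proof (intro conjI allI impI)
  fix \<delta> :: real assume \<delta>: "0 < \<delta>"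
  let ?f = "\<lambda>n \<omega>. \<Sum>p\<in>UNIV. \<Sum>q\<in>UNIV. \<bar>U n \<omega> $ p $ q - L $ p $ q\<bar>"
  let ?E = "\<lambda>n. \<Sum>p\<in>UNIV. \<Sum>q\<in>UNIV. expectation (\<lambda>\<omega>. \<bar>U n \<omega> $ p $ q - L $ p $ q\<bar>)"
  have i: "integrable M (\<lambda>\<omega>. \<bar>U n \<omega> $ p $ q - L $ p $ q\<bar>)" for n p q
    using int by auto
  have f: "integrable M (?f n)" "expectation (?f n) = ?E n" for n
    using i by (auto intro!: Bochner_Integration.integrable_sum simp: Bochner_Integration.integral_sum)
  have "(\<lambda>n. ?E n / \<delta>) \<longlonglongrightarrow> (\<Sum>p\<in>(UNIV::'n set). \<Sum>q\<in>(UNIV::'m set). 0) / \<delta>"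
    using \<delta> by (intro tendsto_divide tendsto_sum lim tendsto_const) auto
  then have E0: "(\<lambda>n. ?E n / \<delta>) \<longlonglongrightarrow> 0" by simp
  have "prob {\<omega>\<in>space M. \<delta> < dist (U n \<omega>) L} \<le> ?E n / \<delta>" for n
  proof -
    have "dist (U n \<omega>) L \<le> ?f n \<omega>" for \<omega>
    proof -
      have "norm A \<le> (\<Sum>p\<in>UNIV. norm (A $ p))" for A :: "real ^ 'm ^ 'n"
        unfolding norm_vec_def[of A] by (rule L2_set_le_sum) simp
      then have "norm A \<le> (\<Sum>p\<in>UNIV. \<Sum>q\<in>UNIV. \<bar>A $ p $ q\<bar>)" for A :: "real ^ 'm ^ 'n"
        by (rule order_trans) (intro sum_mono norm_le_l1_cart)
      from this[of "U n \<omega> - L"] show ?thesis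
        by (simp add: dist_norm)
    qed
    then have "prob {\<omega>\<in>space M. \<delta> < dist (U n \<omega>) L} \<le> prob {\<omega>\<in>space M. \<delta> \<le> ?f n \<omega>}"
      using f(1)[of n] by (intro finite_measure_mono) (auto intro: less_imp_le less_le_trans)
    also have "\<dots> \<le> expectation (?f n) / \<delta>"
      using f(1) \<delta> by (intro integral_Markov_inequality_measure[where A="{}"]) (auto intro!: AE_I2 sum_nonneg)
    finally show ?thesis by (simp only: f)
  qed
  then show "(\<lambda>n. prob {\<omega>\<in>space M. \<delta> < dist (U n \<omega>) L}) \<longlonglongrightarrow> 0"
    by (intro tendsto_sandwich[OF _ _ tendsto_const E0]) auto
qed auto

end

lemma borel_measurable_outer [measurable]: "outer \<in> borel_measurable borel"
  unfolding outer_def by (intro borel_measurable_continuous_onI continuous_intros)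

text \<open>The statistical half, separated from stochastic calculus: the dynamics of
  \<open>X\<close> enter only through \<open>incr\<close>, next to measurability and finite fourth
  moments. The estimator is compared in L1 with \<open>T n\<close>, its value when the signal is
  removed, and \<open>T n\<close> with the limit.\<close>

lemma (in prob_space) noise_cov_estimator_consistent:
  fixes X :: "real \<Rightarrow> 'a \<Rightarrow> real ^ 'd" and \<epsilon> :: "nat \<Rightarrow> nat \<Rightarrow> 'a \<Rightarrow> real ^ 'd"
  assumes S: "transpose S = S"
    and X: "\<And>t. 0 \<le> t \<Longrightarrow> X t \<in> borel_measurable M"
      "\<And>t. 0 \<le> t \<Longrightarrow> integrable M (\<lambda>\<omega>. norm (X t \<omega>) ^ 4)"
    and incr: "\<And>\<eta>. 0 < \<eta> \<Longrightarrow> \<exists>r>0. \<forall>s t. 0 \<le> s \<and> s \<le> t \<and> t \<le> s + r \<longrightarrow>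
      expectation (\<lambda>\<omega>. (norm (X t \<omega> - X s \<omega>))\<^sup>2) \<le> \<eta>"
    and noise: "iid_standard_noise M w x0 \<epsilon>"
    and K: "\<And>n i. i \<le> n \<Longrightarrow> integrable M (\<lambda>\<omega>. norm (\<epsilon> n i \<omega>) ^ 4)"
      "\<And>n i. i \<le> n \<Longrightarrow> expectation (\<lambda>\<omega>. norm (\<epsilon> n i \<omega>) ^ 4) \<le> K"
    and h: "\<And>n. 0 < h n" "h \<longlonglongrightarrow> 0"
  shows "conv_in_prob M (noise_cov_estimator (observation X S \<epsilon> h)) (\<lambda>_. S ** S) sequentially"
proof (rule conv_in_prob_matrixI)
  define U where "U n i \<omega> = X (real (Suc i) * h n) \<omega> - X (real i * h n) \<omega>" for n i \<omega>
  define v where "v n i \<omega> = \<epsilon> n (Suc i) \<omega> - \<epsilon> n i \<omega>" for n i \<omega>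
  define y where "y n i \<omega> = S *v v n i \<omega>" for n i \<omega>
  let ?est = "noise_cov_estimator (observation X S \<epsilon> h)"
  have Y: "observation X S \<epsilon> h n (Suc i) \<omega> - observation X S \<epsilon> h n i \<omega> = U n i \<omega> + y n i \<omega>" for n i \<omega>
    by (simp add: observation_def U_def v_def y_def matrix_vector_mult_diff_distrib)
  have est: "?est n \<omega> $ p $ q =
      (1 / (2 * real n)) * (\<Sum>i<n. (U n i \<omega> + y n i \<omega>) $ p * (U n i \<omega> + y n i \<omega>) $ q)" for n \<omega> p q
    unfolding noise_cov_estimator_def Y by (simp add: outer_def sum_component)
  have Xm [measurable]: "X (real i * h n) \<in> borel_measurable M" for n i
    using X(1) h(1)[of n] by simp
  have \<epsilon>m [measurable]: "\<epsilon> n i \<in> borel_measurable M" if "i \<le> n" for n i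
    using noise that by (simp add: iid_standard_noise_def)
  have Um [measurable]: "U n i \<in> borel_measurable M" for n i
    unfolding U_def by measurable
  have vm [measurable]: "v n i \<in> borel_measurable M" if "i < n" for n i
    unfolding v_def using \<epsilon>m[of i n] \<epsilon>m[of "Suc i" n] that by simp
  have ym [measurable]: "y n i \<in> borel_measurable M" if "i < n" for n i
    unfolding y_def using vm[OF that]
    by (rule borel_measurable_continuous_on[rotated]) (intro linear_continuous_on matrix_vector_mul_bounded_linear)
  have estm: "?est n \<in> borel_measurable M" for n
  proof -
    have "(\<lambda>\<omega>. outer (U n i \<omega> + y n i \<omega>)) \<in> borel_measurable M" if "i < n" for i
      using that by measurable
    then show ?thesis
      unfolding noise_cov_estimator_def Y by measurable
  qed
  then show "?est n \<in> borel_measurable M" for n .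
  have U2: "integrable M (\<lambda>\<omega>. (norm (U n i \<omega>))\<^sup>2)" for n i
    unfolding U_def using X h(1)[of n] by (intro square_norm_diff_moment) auto
  have v2: "integrable M (\<lambda>\<omega>. (norm (v n i \<omega>))\<^sup>2)"
    "expectation (\<lambda>\<omega>. (norm (v n i \<omega>))\<^sup>2) \<le> 1 + 16 * K" if "i < n" for n i
  proof -
    note m = square_norm_diff_moment[OF \<epsilon>m \<epsilon>m K(1) K(1), of "Suc i" n i n]
    show "integrable M (\<lambda>\<omega>. (norm (v n i \<omega>))\<^sup>2)"
      using m(1) that by (simp add: v_def)
    show "expectation (\<lambda>\<omega>. (norm (v n i \<omega>))\<^sup>2) \<le> 1 + 16 * K"
      using m(2) that K(2)[of i n] K(2)[of "Suc i" n] by (simp add: v_def)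
  qed
  obtain s where s: "0 < s" "\<And>x. norm (S *v x) \<le> norm x * s"
    using bounded_linear.pos_bounded[OF matrix_vector_mul_bounded_linear] by blast
  have y_le: "(norm (y n i \<omega>))\<^sup>2 \<le> s\<^sup>2 * (norm (v n i \<omega>))\<^sup>2" for n i \<omega>
    using power_mono[OF s(2) norm_ge_zero, of "v n i \<omega>" 2] by (simp add: y_def power_mult_distrib mult.commute)
  have prod_le: "\<bar>x $ p * z $ q\<bar> \<le> norm x * norm z" for x z :: "real ^ 'd" and p q
    unfolding abs_mult by (intro mult_mono component_le_norm_cart) auto
  have sq_add: "(a + b)\<^sup>2 \<le> 2 * a\<^sup>2 + 2 * b\<^sup>2" for a b :: real
    using zero_le_power2[of "a - b"] by (simp add: power2_eq_square algebra_simps)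
  have yy: "integrable M (\<lambda>\<omega>. y n i \<omega> $ p * y n i \<omega> $ q)" if "i < n" for n i p q
  proof (rule Bochner_Integration.integrable_bound)
    show "integrable M (\<lambda>\<omega>. s\<^sup>2 * (norm (v n i \<omega>))\<^sup>2)"
      using v2[OF that] by simp
    show "AE \<omega> in M. norm (y n i \<omega> $ p * y n i \<omega> $ q) \<le> norm (s\<^sup>2 * (norm (v n i \<omega>))\<^sup>2)"
      using order_trans[OF prod_le] y_le by (auto intro!: AE_I2 simp: power2_eq_square)
  qed (use ym[OF that] in measurable)
  have UU: "integrable M (\<lambda>\<omega>. (U n i \<omega> + y n i \<omega>) $ p * (U n i \<omega> + y n i \<omega>) $ q)" if "i < n" for n i p q
  proof (rule Bochner_Integration.integrable_bound)
    show "integrable M (\<lambda>\<omega>. 2 * (norm (U n i \<omega>))\<^sup>2 + 2 * (s\<^sup>2 * (norm (v n i \<omega>))\<^sup>2))"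
      using v2[OF that] U2 by simp
    show "(\<lambda>\<omega>. (U n i \<omega> + y n i \<omega>) $ p * (U n i \<omega> + y n i \<omega>) $ q) \<in> borel_measurable M"
      using ym[OF that] by measurable
    show "AE \<omega> in M. norm ((U n i \<omega> + y n i \<omega>) $ p * (U n i \<omega> + y n i \<omega>) $ q)
        \<le> norm (2 * (norm (U n i \<omega>))\<^sup>2 + 2 * (s\<^sup>2 * (norm (v n i \<omega>))\<^sup>2))"
    proof (rule AE_I2)
      fix \<omega>
      have "\<bar>(U n i \<omega> + y n i \<omega>) $ p * (U n i \<omega> + y n i \<omega>) $ q\<bar> \<le> (norm (U n i \<omega> + y n i \<omega>))\<^sup>2"
        using prod_le by (simp add: power2_eq_square del: vector_add_component)
      also have "\<dots> \<le> (norm (U n i \<omega>) + norm (y n i \<omega>))\<^sup>2"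
        by (intro power_mono norm_triangle_ineq) simp
      also have "\<dots> \<le> 2 * (norm (U n i \<omega>))\<^sup>2 + 2 * (s\<^sup>2 * (norm (v n i \<omega>))\<^sup>2)"
        using sq_add[of "norm (U n i \<omega>)" "norm (y n i \<omega>)"] y_le[of n i \<omega>] by linarith
      finally show "norm ((U n i \<omega> + y n i \<omega>) $ p * (U n i \<omega> + y n i \<omega>) $ q)
        \<le> norm (2 * (norm (U n i \<omega>))\<^sup>2 + 2 * (s\<^sup>2 * (norm (v n i \<omega>))\<^sup>2))"
        by simp
    qed
  qed
  show esti: "integrable M (\<lambda>\<omega>. ?est n \<omega> $ p $ q)" for n p q
    unfolding est using UU by (intro integrable_mult_right Bochner_Integration.integrable_sum) auto

  fix p q
  define T where "T n \<omega> = (1 / (2 * real n)) * (\<Sum>i<n. y n i \<omega> $ p * y n i \<omega> $ q)" for n \<omega>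
  have Ti: "integrable M (T n)" for n
    unfolding T_def using yy by (intro integrable_mult_right Bochner_Integration.integrable_sum) auto
  have signal: "(\<lambda>n. expectation (\<lambda>\<omega>. \<bar>?est n \<omega> $ p $ q - T n \<omega>\<bar>)) \<longlonglongrightarrow> 0"
  proof (rule LIMSEQ_I)
    fix \<eta> :: real assume \<eta>: "0 < \<eta>"
    have K0: "0 \<le> K"
      using order_trans[OF Bochner_Integration.integral_nonneg K(2)[of 0 0]] by simp
    \<comment> \<open>The signal error of one summand is at most \<open>?G i\<close>, where \<theta>
      weights the cross terms. It is small enough for the noise part of \<open>?G i\<close>, whose
      second moment is at most \<open>1 + 16 * K\<close>, to have mean at most \<eta>. Only after
      \<theta> is fixed can \<kappa> compensate the factor \<open>1 + 1 / \<theta>\<close> on the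
      signal. The total \<open>3 / 2 * \<eta>\<close> is enough, since averaging with
      \<open>1 / (2 * real n)\<close> halves it.\<close>
    define \<theta> where "\<theta> = \<eta> / (s\<^sup>2 * (1 + 16 * K) + 1)"
    have \<theta>: "0 < \<theta>" "\<theta> * (s\<^sup>2 * (1 + 16 * K)) \<le> \<eta>"
    proof -
      have p: "0 \<le> s\<^sup>2 * (1 + 16 * K)" using K0 by simp
      then show "0 < \<theta>" using \<eta> by (simp add: \<theta>_def)
      have "\<theta> * (s\<^sup>2 * (1 + 16 * K)) \<le> \<theta> * (s\<^sup>2 * (1 + 16 * K) + 1)"
        using \<open>0 < \<theta>\<close> by simp
      also have "\<dots> = \<eta>" using p by (simp add: \<theta>_def)
      finally show "\<theta> * (s\<^sup>2 * (1 + 16 * K)) \<le> \<eta>" .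
    qed
    define \<kappa> where "\<kappa> = \<eta> / (2 * (1 + 1 / \<theta>))"
    have \<kappa>: "0 < \<kappa>" "(1 + 1 / \<theta>) * \<kappa> = \<eta> / 2"
    proof -
      have "0 < 1 + 1 / \<theta>" using \<theta>(1) by (simp add: add_pos_pos)
      moreover have "g * (\<eta> / (2 * g)) = \<eta> / 2" if "0 < g" for g :: real
        using that by simp
      ultimately show "0 < \<kappa>" "(1 + 1 / \<theta>) * \<kappa> = \<eta> / 2"
        using \<eta> unfolding \<kappa>_def by (simp, blast)
    qed
    obtain r where r: "0 < r" "\<And>s t. 0 \<le> s \<Longrightarrow> s \<le> t \<Longrightarrow> t \<le> s + r \<Longrightarrow>
        expectation (\<lambda>\<omega>. (norm (X t \<omega> - X s \<omega>))\<^sup>2) \<le> \<kappa>"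
      using incr[OF \<kappa>(1)] by blast
    obtain n0 where n0: "\<And>n. n0 \<le> n \<Longrightarrow> \<bar>h n\<bar> < r"
      using LIMSEQ_D[OF h(2) r(1)] by auto
    have "expectation (\<lambda>\<omega>. \<bar>?est n \<omega> $ p $ q - T n \<omega>\<bar>) < \<eta>" if n: "n0 \<le> n" for n
    proof (cases "n = 0")
      case True
      then show ?thesis using \<eta> by (simp add: est T_def)
    next
      case False
      let ?R = "\<lambda>i \<omega>. (U n i \<omega> + y n i \<omega>) $ p * (U n i \<omega> + y n i \<omega>) $ q - y n i \<omega> $ p * y n i \<omega> $ q"
      let ?G = "\<lambda>i \<omega>. (1 + 1 / \<theta>) * (norm (U n i \<omega>))\<^sup>2 + \<theta> * (s\<^sup>2 * (norm (v n i \<omega>))\<^sup>2)"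
      have G: "integrable M (?G i)" "expectation (?G i) \<le> 3 / 2 * \<eta>" if i: "i < n" for i
      proof -
        show "integrable M (?G i)" using U2 v2[OF i] by simp
        have "real (Suc i) * h n = real i * h n + h n" by (simp add: algebra_simps)
        then have "expectation (\<lambda>\<omega>. (norm (U n i \<omega>))\<^sup>2) \<le> \<kappa>"
          unfolding U_def using n0[OF n] h(1)[of n] by (intro r(2)) auto
        then have "(1 + 1 / \<theta>) * expectation (\<lambda>\<omega>. (norm (U n i \<omega>))\<^sup>2) \<le> (1 + 1 / \<theta>) * \<kappa>"
          using \<theta>(1) by (intro mult_left_mono) auto
        moreover have "\<theta> * (s\<^sup>2 * expectation (\<lambda>\<omega>. (norm (v n i \<omega>))\<^sup>2)) \<le> \<theta> * (s\<^sup>2 * (1 + 16 * K))"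
          using v2(2)[OF i] \<theta>(1) by (intro mult_left_mono) auto
        ultimately show "expectation (?G i) \<le> 3 / 2 * \<eta>"
          using U2[of n i] v2(1)[OF i] \<kappa>(2) \<theta>(2) by simp
      qed
      have R_le: "\<bar>?R i \<omega>\<bar> \<le> ?G i \<omega>" for i \<omega>
      proof -
        let ?u = "U n i \<omega>" and ?y = "y n i \<omega>"
        have "?R i \<omega> = ?u $ p * ?u $ q + ?u $ p * ?y $ q + ?y $ p * ?u $ q"
          by (simp add: algebra_simps)
        then have "\<bar>?R i \<omega>\<bar> \<le> \<bar>?u $ p * ?u $ q\<bar> + \<bar>?u $ p * ?y $ q\<bar> + \<bar>?y $ p * ?u $ q\<bar>"
          by linarith
        also have "\<dots> \<le> (norm ?u)\<^sup>2 + 2 * (norm ?u * norm ?y)"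
          using prod_le[of ?u p ?u q] prod_le[of ?u p ?y q] prod_le[of ?y p ?u q]
          by (simp add: power2_eq_square mult.commute)
        \<comment> \<open>Weighted AM-GM: the square of \<open>norm ?u - \<theta> * norm ?y\<close>
          is nonnegative, and dividing by \<theta> gives the claim.\<close>
        also have "2 * (norm ?u * norm ?y) \<le> 1 / \<theta> * (norm ?u)\<^sup>2 + \<theta> * (norm ?y)\<^sup>2"
          using zero_le_power2[of "norm ?u - \<theta> * norm ?y"] \<theta>(1)
          by (simp add: power2_eq_square field_simps)
        also have "\<theta> * (norm ?y)\<^sup>2 \<le> \<theta> * (s\<^sup>2 * (norm (v n i \<omega>))\<^sup>2)"
          using y_le \<theta>(1) by (intro mult_left_mono) auto
        finally show ?thesis by (simp add: algebra_simps)
      qed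
      have Rsum: "\<bar>?est n \<omega> $ p $ q - T n \<omega>\<bar> \<le> (1 / (2 * real n)) * (\<Sum>i<n. ?G i \<omega>)" for \<omega>
      proof -
        have "?est n \<omega> $ p $ q - T n \<omega> = (1 / (2 * real n)) * (\<Sum>i<n. ?R i \<omega>)"
          unfolding est T_def sum_subtractf right_diff_distrib ..
        moreover have "\<bar>\<Sum>i<n. ?R i \<omega>\<bar> \<le> (\<Sum>i<n. ?G i \<omega>)"
          by (rule order_trans[OF sum_abs sum_mono[OF R_le]])
        then have "(1 / (2 * real n)) * \<bar>\<Sum>i<n. ?R i \<omega>\<bar> \<le> (1 / (2 * real n)) * (\<Sum>i<n. ?G i \<omega>)"
          by (rule mult_left_mono) simp
        ultimately show ?thesis
          by (simp only: abs_mult) simp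
      qed
      have "expectation (\<lambda>\<omega>. \<bar>?est n \<omega> $ p $ q - T n \<omega>\<bar>) \<le>
          expectation (\<lambda>\<omega>. (1 / (2 * real n)) * (\<Sum>i<n. ?G i \<omega>))"
        using esti Ti G(1) Rsum
        by (intro integral_mono integrable_mult_right Bochner_Integration.integrable_sum
            Bochner_Integration.integrable_diff integrable_abs) auto
      also have "\<dots> = (1 / (2 * real n)) * expectation (\<lambda>\<omega>. \<Sum>i<n. ?G i \<omega>)"
        by (rule Bochner_Integration.integral_mult_right_zero)
      also have "expectation (\<lambda>\<omega>. \<Sum>i<n. ?G i \<omega>) = (\<Sum>i<n. expectation (?G i))"
        using G(1) by (intro Bochner_Integration.integral_sum) auto
      also have "(1 / (2 * real n)) * \<dots> \<le> (1 / (2 * real n)) * (\<Sum>i<n. 3 / 2 * \<eta>)"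
        using G(2) by (intro mult_left_mono sum_mono) auto
      also have "\<dots> < \<eta>"
        using False \<eta> by (simp add: field_simps)
      finally show ?thesis .
    qed
    then show "\<exists>n0. \<forall>n\<ge>n0. norm (expectation (\<lambda>\<omega>. \<bar>?est n \<omega> $ p $ q - T n \<omega>\<bar>) - 0) < \<eta>"
      by (auto intro!: exI[of _ n0])
  qed
  have noise_part: "(\<lambda>n. expectation (\<lambda>\<omega>. \<bar>T n \<omega> - (S ** S) $ p $ q\<bar>)) \<longlonglongrightarrow> 0"
  proof -
    define Z where "Z n k l \<omega> = (1 / (2 * real n)) *
      (\<Sum>i<n. (\<epsilon> n (Suc i) \<omega> - \<epsilon> n i \<omega>) $ k * (\<epsilon> n (Suc i) \<omega> - \<epsilon> n i \<omega>) $ l) - mat 1 $ k $ l" for n k l \<omega>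
    have Z: "integrable M (Z n k l)"
      "expectation (\<lambda>\<omega>. \<bar>Z n k l \<omega>\<bar>) \<le> sqrt (3 * (32 * K + 8) / (4 * real n))" if "0 < n" for n k l
    proof -
      have "indep_sets (source_sets M w x0 (\<epsilon> n)) ({Driver, Initial} \<union> {Noise i j |i j. i \<le> n})"
        using noise by (simp add: iid_standard_noise_def)
      then have ind: "indep_sets (source_sets M w x0 (\<epsilon> n)) {Noise i j |i j. i \<le> n}"
        by (rule indep_sets_mono_index[rotated]) auto
      have iid: "integrable M (\<epsilon> n i)" "expectation (\<epsilon> n i) = 0"
        "integrable M (\<lambda>\<omega>. outer (\<epsilon> n i \<omega>))" "expectation (\<lambda>\<omega>. outer (\<epsilon> n i \<omega>)) = mat 1" if "i \<le> n" for i
        using noise that unfolding iid_standard_noise_def by blast+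
      note prod = noise_increment_products[where e="\<epsilon> n" and n=n, OF \<epsilon>m ind iid K that]
      show "integrable M (Z n k l)"
        unfolding Z_def[abs_def] by (rule prod(1))
      show "expectation (\<lambda>\<omega>. \<bar>Z n k l \<omega>\<bar>) \<le> sqrt (3 * (32 * K + 8) / (4 * real n))"
        unfolding Z_def[abs_def] by (rule prod(2))
    qed
    \<comment> \<open>The matrix \<open>S\<close> enters bilinearly and is deterministic, so
      \<open>T n\<close> minus its limit is a fixed linear combination of the scalar errors
      \<open>Z n k l\<close>, each of order \<open>1 / sqrt n\<close> in L1.\<close>
    have Tn: "T n \<omega> - (S ** S) $ p $ q = (\<Sum>k\<in>UNIV. \<Sum>l\<in>UNIV. S $ p $ k * S $ q $ l * Z n k l \<omega>)" for n \<omega>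
    proof -
      have yc: "y n i \<omega> $ p * y n i \<omega> $ q =
          (\<Sum>k\<in>UNIV. \<Sum>l\<in>UNIV. S $ p $ k * S $ q $ l * (v n i \<omega> $ k * v n i \<omega> $ l))" for i
        by (simp add: y_def matrix_vector_mult_def sum_product mult_ac)
      have "T n \<omega> = (\<Sum>i<n. \<Sum>k\<in>UNIV. \<Sum>l\<in>UNIV.
          S $ p $ k * S $ q $ l * ((1 / (2 * real n)) * (v n i \<omega> $ k * v n i \<omega> $ l)))"
        unfolding T_def yc sum_distrib_left by (simp add: mult_ac)
      also have "\<dots> = (\<Sum>k\<in>UNIV. \<Sum>i<n. \<Sum>l\<in>UNIV.
          S $ p $ k * S $ q $ l * ((1 / (2 * real n)) * (v n i \<omega> $ k * v n i \<omega> $ l)))"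
        by (rule sum.swap)
      also have "\<dots> = (\<Sum>k\<in>UNIV. \<Sum>l\<in>UNIV. \<Sum>i<n.
          S $ p $ k * S $ q $ l * ((1 / (2 * real n)) * (v n i \<omega> $ k * v n i \<omega> $ l)))"
        by (intro sum.cong refl sum.swap)
      also have "\<dots> = (\<Sum>k\<in>UNIV. \<Sum>l\<in>UNIV. S $ p $ k * S $ q $ l * (Z n k l \<omega> + mat 1 $ k $ l))"
        by (simp only: Z_def v_def sum_distrib_left diff_add_cancel)
      finally have T: "T n \<omega> = (\<Sum>k\<in>UNIV. \<Sum>l\<in>UNIV. S $ p $ k * S $ q $ l * (Z n k l \<omega> + mat 1 $ k $ l))" .
      \<comment> \<open>The outer products of \<open>S *v v n i \<omega>\<close> produce S times the
        transpose of S; symmetry turns this into \<open>S ** S\<close>.\<close>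
      have Ssym: "S $ l $ q = S $ q $ l" for l
        using arg_cong[OF S, of "\<lambda>A. A $ q $ l"] by (simp add: transpose_def)
      have "(S ** S) $ p $ q = (\<Sum>k\<in>UNIV. \<Sum>l\<in>UNIV. S $ p $ k * S $ q $ l * mat 1 $ k $ l)"
        by (simp add: matrix_matrix_mult_def mat_def Ssym if_distrib cong: if_cong)
      then show ?thesis
        unfolding T by (simp add: distrib_left sum.distrib)
    qed
    show ?thesis
    proof (rule tendsto_sandwich[OF _ _ tendsto_const])
      let ?C = "\<lambda>n. \<Sum>k\<in>UNIV. \<Sum>l\<in>UNIV. \<bar>S $ p $ k * S $ q $ l\<bar> * sqrt (3 * (32 * K + 8) / (4 * real n))"
      show "\<forall>\<^sub>F n in sequentially. 0 \<le> expectation (\<lambda>\<omega>. \<bar>T n \<omega> - (S ** S) $ p $ q\<bar>)"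
        by simp
      show "\<forall>\<^sub>F n in sequentially. expectation (\<lambda>\<omega>. \<bar>T n \<omega> - (S ** S) $ p $ q\<bar>) \<le> ?C n"
        using eventually_gt_at_top[of 0]
      proof eventually_elim
        case (elim n)
        let ?Z = "\<lambda>\<omega>. \<Sum>k\<in>UNIV. \<Sum>l\<in>UNIV. \<bar>S $ p $ k * S $ q $ l\<bar> * \<bar>Z n k l \<omega>\<bar>"
        have "\<bar>T n \<omega> - (S ** S) $ p $ q\<bar> \<le> ?Z \<omega>" for \<omega>
          unfolding Tn by (intro order_trans[OF sum_abs sum_mono]) (simp add: abs_mult)
        then have "expectation (\<lambda>\<omega>. \<bar>T n \<omega> - (S ** S) $ p $ q\<bar>) \<le> expectation ?Z"
          using Z(1)[OF elim] Ti
          by (intro integral_mono Bochner_Integration.integrable_sum integrable_mult_right integrable_abs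
              Bochner_Integration.integrable_diff) auto
        also have "\<dots> = (\<Sum>k\<in>UNIV. \<Sum>l\<in>UNIV. \<bar>S $ p $ k * S $ q $ l\<bar> * expectation (\<lambda>\<omega>. \<bar>Z n k l \<omega>\<bar>))"
          using Z(1)[OF elim]
          by (subst Bochner_Integration.integral_sum)
             (auto intro!: sum.cong Bochner_Integration.integrable_sum simp: Bochner_Integration.integral_sum)
        also have "\<dots> \<le> ?C n"
          using Z(2)[OF elim] by (intro sum_mono mult_left_mono) auto
        finally show ?case .
      qed
      have "(\<lambda>n. sqrt (3 * (32 * K + 8) / (4 * real n))) \<longlonglongrightarrow> sqrt 0"
      proof (rule tendsto_real_sqrt)
        have "(\<lambda>n. (3 * (32 * K + 8) / 4) * (1 / real n)) \<longlonglongrightarrow> (3 * (32 * K + 8) / 4) * 0"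
          by (intro tendsto_mult tendsto_const lim_1_over_n)
        then show "(\<lambda>n. 3 * (32 * K + 8) / (4 * real n)) \<longlonglongrightarrow> 0"
          by simp
      qed
      then have "?C \<longlonglongrightarrow> (\<Sum>k\<in>UNIV. \<Sum>l\<in>UNIV. \<bar>S $ p $ k * S $ q $ l\<bar> * sqrt 0)"
        by (intro tendsto_sum tendsto_mult tendsto_const)
      then show "?C \<longlonglongrightarrow> 0"
        by simp
    qed
  qed
  show "(\<lambda>n. expectation (\<lambda>\<omega>. \<bar>?est n \<omega> $ p $ q - (S ** S) $ p $ q\<bar>)) \<longlonglongrightarrow> 0"
  proof (rule tendsto_sandwich[OF _ _ tendsto_const])
    show "\<forall>\<^sub>F n in sequentially. 0 \<le> expectation (\<lambda>\<omega>. \<bar>?est n \<omega> $ p $ q - (S ** S) $ p $ q\<bar>)"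
      by simp
    show "\<forall>\<^sub>F n in sequentially. expectation (\<lambda>\<omega>. \<bar>?est n \<omega> $ p $ q - (S ** S) $ p $ q\<bar>) \<le>
        expectation (\<lambda>\<omega>. \<bar>?est n \<omega> $ p $ q - T n \<omega>\<bar>) + expectation (\<lambda>\<omega>. \<bar>T n \<omega> - (S ** S) $ p $ q\<bar>)"
    proof (intro always_eventually allI)
      fix n
      have "expectation (\<lambda>\<omega>. \<bar>?est n \<omega> $ p $ q - (S ** S) $ p $ q\<bar>) \<le>
          expectation (\<lambda>\<omega>. \<bar>?est n \<omega> $ p $ q - T n \<omega>\<bar> + \<bar>T n \<omega> - (S ** S) $ p $ q\<bar>)"
        using esti Ti by (intro integral_mono) auto
      also have "\<dots> = expectation (\<lambda>\<omega>. \<bar>?est n \<omega> $ p $ q - T n \<omega>\<bar>) +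
          expectation (\<lambda>\<omega>. \<bar>T n \<omega> - (S ** S) $ p $ q\<bar>)"
        using esti Ti by (intro Bochner_Integration.integral_add) auto
      finally show "expectation (\<lambda>\<omega>. \<bar>?est n \<omega> $ p $ q - (S ** S) $ p $ q\<bar>) \<le>
        expectation (\<lambda>\<omega>. \<bar>?est n \<omega> $ p $ q - T n \<omega>\<bar>) + expectation (\<lambda>\<omega>. \<bar>T n \<omega> - (S ** S) $ p $ q\<bar>)" .
    qed
    show "(\<lambda>n. expectation (\<lambda>\<omega>. \<bar>?est n \<omega> $ p $ q - T n \<omega>\<bar>) +
        expectation (\<lambda>\<omega>. \<bar>T n \<omega> - (S ** S) $ p $ q\<bar>)) \<longlonglongrightarrow> 0"
      using tendsto_add[OF signal noise_part] by simp
  qed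
qed

section \<open>Constants drawn from the assumptions on coefficients, process and noise\<close>

lemma linear_growth_norm_le:
  assumes "linear_growth f"
  obtains C where "0 < C" "\<And>x. norm (f x) \<le> C * (1 + norm x)"
proof -
  obtain C where C: "0 < C" "\<And>x. norm (f x) + deriv_norm 1 f x + deriv_norm 2 f x \<le> C * (1 + norm x)"
    using assms by (auto simp: linear_growth_def)
  have "0 \<le> deriv_norm k f x" for k x
    by (simp add: deriv_norm_def sum_nonneg)
  with C(2) have "norm (f x) \<le> C * (1 + norm x)" for x
    by (smt (verit))
  with C(1) show ?thesis by (rule that)
qed

theorem lemma1:
  fixes M :: "'a measure"
    and \<Theta>1 :: "(real ^ 'm1) set" and \<Theta>2 :: "(real ^ 'm2) set"
    and \<Theta>\<epsilon> :: "(real, 'd :: {finite, linorder} low_pos) vec set"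
    and b :: "(real, 'd) vec \<Rightarrow> real ^ 'm2 \<Rightarrow> (real, 'd) vec"
    and a :: "(real, 'd) vec \<Rightarrow> real ^ 'm1 \<Rightarrow> (real ^ 'r, 'd) vec"
    and \<alpha> :: "real ^ 'm1" and \<beta> :: "real ^ 'm2"
    and w :: "real \<Rightarrow> 'a \<Rightarrow> real ^ 'r"
    and x0 :: "'a \<Rightarrow> (real, 'd) vec"
    and X :: "real \<Rightarrow> 'a \<Rightarrow> (real, 'd) vec"
    and \<nu>0 :: "(real, 'd) vec measure"
    and \<Lambda> S :: "((real, 'd) vec, 'd) vec"
    and \<epsilon> :: "nat \<Rightarrow> nat \<Rightarrow> 'a \<Rightarrow> (real, 'd) vec"
    and h :: "nat \<Rightarrow> real"
  assumes "prob_space M"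
    and "compact \<Theta>1" "convex \<Theta>1" "compact \<Theta>2" "convex \<Theta>2"
    and "(\<alpha>, \<beta>) \<in> interior (\<Theta>1 \<times> \<Theta>2)"
    and "standard_wiener M w"
    and "x0 \<in> borel_measurable M"
    and "sde_solution M w (\<lambda>x. b x \<beta>) (\<lambda>x. a x \<alpha>) x0 X"
    and "compact \<Theta>\<epsilon>" "convex \<Theta>\<epsilon>"
    and "pos_semidef \<Lambda>" "vech \<Lambda> \<in> interior \<Theta>\<epsilon>" "psd_sqrt \<Lambda> S"
    and "iid_standard_noise M w x0 \<epsilon>"
    and A1: "regular_coefficients \<Theta>1 \<Theta>2 b a \<alpha> \<beta>"
    and A2: "ergodic_with M w (\<lambda>x. b x \<beta>) (\<lambda>x. a x \<alpha>) X \<nu>0"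
      "\<And>k::real. k > 0 \<Longrightarrow> integrable \<nu>0 (\<lambda>x. norm x powr k)"
    and A3: "\<And>k::real. k > 0 \<Longrightarrow>
      (SUP t\<in>{0..}. \<integral>\<^sup>+ \<omega>. ennreal (norm (X t \<omega>) powr k) \<partial>M) < \<infinity>"
    and A4: "\<And>n i (k::real). i \<le> n \<Longrightarrow> k > 0 \<Longrightarrow> integrable M (\<lambda>\<omega>. norm (\<epsilon> n i \<omega>) powr k)"
      "\<And>n i j. i \<le> n \<Longrightarrow>
        distr M borel (\<lambda>\<omega>. \<epsilon> n i \<omega> $ j) = distr M borel (\<lambda>\<omega>. - (\<epsilon> n i \<omega> $ j))"
    and "\<And>n. h n > 0"
    and "h \<longlonglongrightarrow> 0"
    and "filterlim (\<lambda>n. real n * h n) at_top sequentially"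
  shows "conv_in_prob M (noise_cov_estimator (observation X S \<epsilon> h)) (\<lambda>\<omega>. \<Lambda>) sequentially"
proof -
  interpret prob_space M by fact
  have growth: "linear_growth (\<lambda>x. b x \<beta>)" "linear_growth (\<lambda>x. a x \<alpha>)"
    using A1 by (simp_all add: regular_coefficients_def)
  obtain Cb where "0 < Cb" and Cb: "\<And>x. norm (b x \<beta>) \<le> Cb * (1 + norm x)"
    using linear_growth_norm_le[OF growth(1)] by metis
  obtain Ca where Ca: "\<And>x. norm (a x \<alpha>) \<le> Ca * (1 + norm x)"
    using linear_growth_norm_le[OF growth(2)] by metis
  define C where "C = max Cb Ca"
  have C: "0 < C" "norm (b x \<beta>) \<le> C * (1 + norm x)" "norm (a x \<alpha>) \<le> C * (1 + norm x)" for x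
    using \<open>0 < Cb\<close> order_trans[OF Cb mult_right_mono] order_trans[OF Ca mult_right_mono]
    by (auto simp: C_def)
  have X: "X t \<in> borel_measurable M" if t: "0 \<le> t" for t
  proof -
    obtain F where "subalgebra M (F t)" "X t \<in> borel_measurable (F t)"
      using \<open>sde_solution M w (\<lambda>x. b x \<beta>) (\<lambda>x. a x \<alpha>) x0 X\<close> t
      unfolding sde_solution_def wiener_wrt_def by blast
    then show ?thesis
      by (rule measurable_from_subalg)
  qed
  obtain K where K: "0 < K" "\<And>t. 0 \<le> t \<Longrightarrow> (\<integral>\<^sup>+\<omega>. ennreal (norm (X t \<omega>) ^ 4) \<partial>M) \<le> ennreal K"
  proof -
    \<comment> \<open>Adding 1 to the supremum makes the constant strictly positive, as the
      increment estimate demands, even if \<open>X\<close> vanishes almost surely.\<close>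
    let ?S = "SUP t\<in>{0..}. \<integral>\<^sup>+ \<omega>. ennreal (norm (X t \<omega>) powr 4) \<partial>M"
    have "?S < \<infinity>"
      using A3[of 4] by simp
    then have S: "?S \<le> ennreal (enn2real ?S + 1)"
      by (simp add: ennreal_plus less_top)
    have "(\<integral>\<^sup>+\<omega>. ennreal (norm (X t \<omega>) ^ 4) \<partial>M) \<le> ennreal (enn2real ?S + 1)" if "0 \<le> t" for t
      by (rule order_trans[OF _ S]) (use that in \<open>auto intro!: SUP_upper2[of t]\<close>)
    then show thesis
      by (intro that[of "enn2real ?S + 1"]) (auto intro: add_nonneg_pos)
  qed
  have \<epsilon>: "\<epsilon> n i \<in> borel_measurable M" "distr M borel (\<epsilon> n i) = distr M borel (\<epsilon> 0 0)" if "i \<le> n" for n i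
    using \<open>iid_standard_noise M w x0 \<epsilon>\<close> that unfolding iid_standard_noise_def by blast+
  have S: "transpose S = S" "S ** S = \<Lambda>"
    using \<open>psd_sqrt \<Lambda> S\<close> by (auto simp: psd_sqrt_def pos_semidef_def)
  have "conv_in_prob M (noise_cov_estimator (observation X S \<epsilon> h)) (\<lambda>_. S ** S) sequentially"
  \<comment> \<open>The law of the noise depends neither on \<open>n\<close> nor on
    \<open>i\<close>, so the fourth moment of \<open>\<epsilon> 0 0\<close> serves as a common bound
    for the whole triangular array.\<close>
  proof (rule noise_cov_estimator_consistent[where X=X and K="expectation (\<lambda>\<omega>. norm (\<epsilon> 0 0 \<omega>) ^ 4)"])
    show "integrable M (\<lambda>\<omega>. norm (X t \<omega>) ^ 4)" if "0 \<le> t" for t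
      using X[OF that] K(1) K(2)[OF that] by (intro integrable_nn_integral_le(1)[of _ _ K]) auto
    show "\<exists>r>0. \<forall>s t. 0 \<le> s \<and> s \<le> t \<and> t \<le> s + r \<longrightarrow>
        expectation (\<lambda>\<omega>. (norm (X t \<omega> - X s \<omega>))\<^sup>2) \<le> \<eta>" if "0 < \<eta>" for \<eta>
      using K(1)
      by (intro sde_increment_L2[OF \<open>prob_space M\<close>
          \<open>sde_solution M w (\<lambda>x. b x \<beta>) (\<lambda>x. a x \<alpha>) x0 X\<close> C _ K(2) X that]) auto
    show "integrable M (\<lambda>\<omega>. norm (\<epsilon> n i \<omega>) ^ 4)" if "i \<le> n" for n i
      using A4(1)[OF that, of 4] by simp
    show "expectation (\<lambda>\<omega>. norm (\<epsilon> n i \<omega>) ^ 4) \<le> expectation (\<lambda>\<omega>. norm (\<epsilon> 0 0 \<omega>) ^ 4)" if "i \<le> n" for n i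
      using integral_distr[OF \<epsilon>(1)[OF that], of "\<lambda>x. norm x ^ 4"]
        integral_distr[OF \<epsilon>(1)[of 0 0], of "\<lambda>x. norm x ^ 4"] \<epsilon>(2)[OF that] by simp
  qed (use S X assms in auto)
  then show ?thesis
    unfolding S .
qed

end
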